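(* Let $D$ be an almost Dedekind domain with $\mathrm{Jac}({}^{\omega}T_1)\neq(0)$. Then $D$ is not completely unbounded.
   Context: An almost Dedekind domain is an integral domain $D$ such that $D_M$ is a discrete valuation ring for every maximal ideal $M$ of $D$. For a nonzero fractional ideal $I$, let $\nu_I:\mathrm{Max}(D)\to\mathbb{Z}$, $\nu_I(M):=v_M(I)$, where $v_M$ is the valuation of $D_M$. A nonzero proper ideal $I$ of $D$ is bounded if $\nu_I$ is a bounded function. A maximal ideal $M$ of $D$ is $\omega$-critical if it does not contain any bounded finitely generated ideal (bounded ideals are by definition nonzero and proper); ${}^{\omega}\mathrm{Crit}(D)$ is the set of $\omega$-critical maximal ideals of $D$. Set ${}^{\omega}T_1:=\bigcap\{D_P\mid P\in{}^{\omega}\mathrm{Crit}(D)\}$, an overring of $D$ whose maximal ideals are the extensions of the elements of ${}^{\omega}\mathrm{Crit}(D)$ (if ${}^{\omega}\mathrm{Crit}(D)=\emptyset$, then ${}^{\omega}T_1$ is the quotient field of $D$). $\mathrm{Jac}(R)$ is the Jacobson radical of $R$, the intersection of all maximal ideals of $R$. $D$ is completely unbounded if no nonzero proper principal ideal of $D$ is bounded. *)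

theory Defs
  imports "HOL-Algebra.Algebra"
begin

text \<open>
  An integral domain \<open>D\<close> is given together with its quotient field \<open>K\<close>, as a subring of
  \<open>K\<close>; all overrings of \<open>D\<close> are then subsets of \<open>carrier K\<close>.
\<close>

abbreviation subring_of :: "('a, 'm) ring_scheme \<Rightarrow> 'a set \<Rightarrow> ('a, 'm) ring_scheme"
  where "subring_of K S \<equiv> K\<lparr>carrier := S\<rparr>"

definition is_quotient_field :: "('a, 'm) ring_scheme \<Rightarrow> 'a set \<Rightarrow> bool"
  where "is_quotient_field K D \<longleftrightarrow>
    field K \<and> subdomain D K \<and>
    (\<forall>x\<in>carrier K. \<exists>a\<in>D. \<exists>b\<in>D - {\<zero>\<^bsub>K\<^esub>}. x = a \<otimes>\<^bsub>K\<^esub> inv\<^bsub>K\<^esub> b)"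

definition max_spec :: "('a, 'm) ring_scheme \<Rightarrow> 'a set set"
  where "max_spec R = {M. maximalideal M R}"

definition jacobson_radical :: "('a, 'm) ring_scheme \<Rightarrow> 'a set"
  where "jacobson_radical R = carrier R \<inter> \<Inter>(max_spec R)"

definition localization :: "('a, 'm) ring_scheme \<Rightarrow> 'a set \<Rightarrow> 'a set \<Rightarrow> 'a set"
  where "localization K D P = {a \<otimes>\<^bsub>K\<^esub> inv\<^bsub>K\<^esub> s | a s. a \<in> D \<and> s \<in> D - P}"

definition discrete_valuation_ring :: "('a, 'm) ring_scheme \<Rightarrow> bool"
  where "discrete_valuation_ring R \<longleftrightarrow>
    principal_domain R \<and> (\<exists>!M. maximalideal M R) \<and> \<not> field R"

definition almost_Dedekind :: "('a, 'm) ring_scheme \<Rightarrow> 'a set \<Rightarrow> bool"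
  where "almost_Dedekind K D \<longleftrightarrow>
    is_quotient_field K D \<and>
    (\<forall>M\<in>max_spec (subring_of K D).
       discrete_valuation_ring (subring_of K (localization K D M)))"

text \<open>
  The normalized valuation on \<open>K\<close> of a discrete valuation ring \<open>V\<close> with quotient field
  \<open>K\<close>: it sends \<open>u t\<^sup>n\<close> to \<open>n\<close>, for \<open>u\<close> a unit and \<open>t\<close> a generator of the maximal
  ideal of \<open>V\<close>. The value at \<open>0\<close> (mathematically infinite) is unspecified.
\<close>

definition dvr_valuation :: "('a, 'm) ring_scheme \<Rightarrow> 'a set \<Rightarrow> 'a \<Rightarrow> int"
  where "dvr_valuation K V x =
    (THE n. \<exists>t\<in>V. \<exists>u\<in>Units (subring_of K V).
       maximalideal (PIdl\<^bsub>subring_of K V\<^esub> t) (subring_of K V) \<and>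
       x = u \<otimes>\<^bsub>K\<^esub> t [^]\<^bsub>K\<^esub> n)"

text \<open>
  For a nonzero fractional ideal \<open>I\<close> the set of values below is nonempty and bounded from
  below, so the infimum in \<open>int\<close> is its minimum.
\<close>

definition ideal_nu :: "('a, 'm) ring_scheme \<Rightarrow> 'a set \<Rightarrow> 'a set \<Rightarrow> 'a set \<Rightarrow> int"
  where "ideal_nu K D I M =
    (INF x\<in>I - {\<zero>\<^bsub>K\<^esub>}. dvr_valuation K (localization K D M) x)"

definition bounded_ideal :: "('a, 'm) ring_scheme \<Rightarrow> 'a set \<Rightarrow> 'a set \<Rightarrow> bool"
  where "bounded_ideal K D I \<longleftrightarrow>
    ideal I (subring_of K D) \<and> I \<noteq> {\<zero>\<^bsub>K\<^esub>} \<and> I \<noteq> D \<and>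
    (\<exists>N. \<forall>M\<in>max_spec (subring_of K D). \<bar>ideal_nu K D I M\<bar> \<le> N)"

definition finitely_generated_ideal :: "'a set \<Rightarrow> ('a, 'm) ring_scheme \<Rightarrow> bool"
  where "finitely_generated_ideal I R \<longleftrightarrow>
    (\<exists>S. finite S \<and> S \<subseteq> carrier R \<and> I = Idl\<^bsub>R\<^esub> S)"

definition omega_Crit :: "('a, 'm) ring_scheme \<Rightarrow> 'a set \<Rightarrow> 'a set set"
  where "omega_Crit K D =
    {M \<in> max_spec (subring_of K D).
       \<not> (\<exists>I. bounded_ideal K D I \<and> finitely_generated_ideal I (subring_of K D) \<and> I \<subseteq> M)}"

text \<open>The intersection with \<open>carrier K\<close> makes this the quotient field if there are no
  \<open>\<omega>\<close>-critical ideals.\<close>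

definition omega_T1 :: "('a, 'm) ring_scheme \<Rightarrow> 'a set \<Rightarrow> 'a set"
  where "omega_T1 K D = carrier K \<inter> (\<Inter>P\<in>omega_Crit K D. localization K D P)"

definition completely_unbounded :: "('a, 'm) ring_scheme \<Rightarrow> 'a set \<Rightarrow> bool"
  where "completely_unbounded K D \<longleftrightarrow>
    \<not> (\<exists>I. principalideal I (subring_of K D) \<and> bounded_ideal K D I)"

end

theory Submission
  imports Defs
begin

text \<open>
  A nonzero element of the Jacobson radical of \<open>T\<^sub>1\<close> yields \<open>a \<in> D\<close>, \<open>a \<noteq> 0\<close>, lying in every
  \<open>\<omega>\<close>-critical ideal. Near a maximal ideal that contains a bounded finitely generated ideal
  every nonzero element has bounded valuation, so by quasi-compactness of the maximal spectrum
  every nonzero element outside all \<open>\<omega>\<close>-critical ideals is bounded. If \<open>a\<close> avoids some maximal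
  ideal \<open>M\<close>, this applies to an element \<open>1 - a y \<in> M\<close>. Otherwise \<open>a\<close> is in the Jacobson
  radical of \<open>D\<close>; then all zero sets \<open>V(x)\<close> in the maximal spectrum are clopen, a Baire category
  argument gives a nonempty \<open>V(s)\<close> on which \<open>v(a)\<close> is at most some \<open>B\<close>, and
  \<open>a + s\<^bsup>B+1\<^esup>\<close> is a nonunit that is bounded by \<open>B\<close>.
\<close>

section \<open>Maximal ideals\<close>

lemma (in cring) idealI_closed:
  assumes "I \<subseteq> carrier R" "\<zero> \<in> I"
    and add: "\<And>x y. x \<in> I \<Longrightarrow> y \<in> I \<Longrightarrow> x \<oplus> y \<in> I"
    and mult: "\<And>r x. r \<in> carrier R \<Longrightarrow> x \<in> I \<Longrightarrow> r \<otimes> x \<in> I"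
  shows "ideal I R"
proof (rule idealI[OF ring_axioms])
  have "\<ominus> x \<in> I" if "x \<in> I" for x
    using mult[of "\<ominus> \<one>" x] that assms(1) by (metis a_inv_closed l_minus l_one one_closed subsetD)
  then show "subgroup I (add_monoid R)"
    using assms by (intro add.subgroupI) auto
  show "x \<otimes> a \<in> I" if "a \<in> I" "x \<in> carrier R" for a x
    using that mult by blast
  show "a \<otimes> x \<in> I" if "a \<in> I" "x \<in> carrier R" for a x
    using that mult assms(1) by (metis m_comm subsetD)
qed

text \<open>Krull's theorem by Zorn's lemma: omitting \<open>\<one>\<close> is the form of
  properness that passes to the union of a chain.\<close>

lemma (in cring) ideal_subset_maximalideal:
  assumes J: "ideal J R" and one: "\<one> \<notin> J"
  obtains M where "maximalideal M R" "J \<subseteq> M"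
proof -
  define A where "A = {I. ideal I R \<and> J \<subseteq> I \<and> \<one> \<notin> I}"
  have "\<exists>M\<in>A. \<forall>I\<in>A. M \<subseteq> I \<longrightarrow> I = M"
  proof (rule subset_Zorn_nonempty)
    show "A \<noteq> {}" using J one by (auto simp: A_def)
    fix C assume C: "C \<noteq> {}" "subset.chain A C"
    have CA: "I \<in> A" if "I \<in> C" for I
      using that C(2) by (auto simp: subset.chain_def)
    then have C_ideal: "ideal I R" if "I \<in> C" for I
      using that by (simp add: A_def)
    have "ideal (\<Union>C) R"
    proof (rule idealI_closed)
      show "\<Union>C \<subseteq> carrier R"
        using ideal.Icarr[OF C_ideal] by auto
      show "\<zero> \<in> \<Union>C"
        using C(1) additive_subgroup.zero_closed[OF ideal.axioms(1)[OF C_ideal]] by auto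
      show "r \<otimes> x \<in> \<Union>C" if "r \<in> carrier R" "x \<in> \<Union>C" for r x
        using that ideal.I_l_closed[OF C_ideal] by auto
      fix x y assume "x \<in> \<Union>C" "y \<in> \<Union>C"
      then obtain I I' where I: "I \<in> C" "I' \<in> C" "x \<in> I" "y \<in> I'" by blast
      then have "I \<subseteq> I' \<or> I' \<subseteq> I"
        using C(2) by (auto simp: subset.chain_def)
      then obtain I'' where "I'' \<in> C" "x \<in> I''" "y \<in> I''"
        using I by blast
      then show "x \<oplus> y \<in> \<Union>C"
        using additive_subgroup.a_closed[OF ideal.axioms(1)[OF C_ideal]] by auto
    qed
    then show "\<Union>C \<in> A"
      using C(1) CA by (auto simp: A_def)
  qed
  then obtain M where M: "M \<in> A" and max: "\<And>I. I \<in> A \<Longrightarrow> M \<subseteq> I \<Longrightarrow> I = M" by blast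
  have "maximalideal M R"
  proof (rule maximalidealI)
    show "ideal M R" using M by (auto simp: A_def)
    show "carrier R \<noteq> M" using M by (auto simp: A_def)
    fix I assume I: "ideal I R" "M \<subseteq> I" "I \<subseteq> carrier R"
    show "I = M \<or> I = carrier R"
    proof (cases "\<one> \<in> I")
      case True
      then show ?thesis using ideal.one_imp_carrier[OF I(1)] by blast
    next
      case False
      then have "I \<in> A" using I M by (auto simp: A_def)
      then show ?thesis using max I by blast
    qed
  qed
  then show thesis using that M by (auto simp: A_def)
qed

lemma (in cring) maximalideal_mult_iff:
  assumes "maximalideal M R" "x \<in> carrier R" "y \<in> carrier R"
  shows "x \<otimes> y \<in> M \<longleftrightarrow> x \<in> M \<or> y \<in> M"
proof -
  interpret primeideal M R by (rule maximalideal_prime[OF assms(1)])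
  show ?thesis using I_prime assms(2,3) I_l_closed I_r_closed by blast
qed

lemma (in cring) one_notin_maximalideal:
  assumes "maximalideal M R" shows "\<one> \<notin> M"
  using ideal.one_imp_carrier[OF maximalideal.axioms(1)[OF assms]] maximalideal.I_notcarr[OF assms]
  by auto

lemma (in cring) maximalideal_add_cancel:
  assumes "maximalideal M R" "x \<in> M" "y \<in> carrier R"
  shows "x \<oplus> y \<in> M \<longleftrightarrow> y \<in> M"
proof -
  interpret maximalideal M R by fact
  have x: "x \<in> carrier R" using assms Icarr by auto
  have "\<ominus> x \<oplus> (x \<oplus> y) = y" using x assms by algebra
  moreover have "\<ominus> x \<in> M" using assms(2) a_inv_closed by blast
  ultimately show ?thesis using a_closed assms(2) by metis
qed

text \<open>The element \<open>y\<close> inverts \<open>x\<close> in the residue field: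
  \<open>M\<close> and \<open>x\<close> together generate the unit ideal.\<close>

lemma (in cring) maximalideal_notin_inverse:
  assumes M: "maximalideal M R" and x: "x \<in> carrier R" "x \<notin> M"
  obtains y where "y \<in> carrier R" "\<one> \<ominus> x \<otimes> y \<in> M"
proof -
  interpret maximalideal M R by fact
  define J where "J = M <+>\<^bsub>R\<^esub> PIdl x"
  have J: "ideal J R"
    unfolding J_def using add_ideals[OF is_ideal cgenideal_ideal[OF x(1)]] .
  have MJ: "m \<oplus> r \<otimes> x \<in> J" if "m \<in> M" "r \<in> carrier R" for m r
    using that by (auto simp: J_def set_add_def' cgenideal_def)
  have "M \<subseteq> J"
    using MJ[of _ \<zero>] x Icarr by auto
  moreover have "x \<in> J"
    using MJ[of \<zero> \<one>] x by auto
  moreover have "J \<subseteq> carrier R"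
    using J by (auto simp: ideal.Icarr)
  ultimately have "\<one> \<in> J"
    using I_maximal[OF J] x by auto
  then obtain m r where mr: "m \<in> M" "r \<in> carrier R" "\<one> = m \<oplus> r \<otimes> x"
    by (auto simp: J_def set_add_def' cgenideal_def)
  have "(m \<oplus> r \<otimes> x) \<ominus> x \<otimes> r = m"
    using mr(2) x(1) Icarr[OF mr(1)] by algebra
  then have "\<one> \<ominus> x \<otimes> r = m" using mr(3) by simp
  then show thesis using that mr by auto
qed

lemma (in cring) zero_in_maximalideal: "maximalideal M R \<Longrightarrow> \<zero> \<in> M"
  by (simp add: additive_subgroup.zero_closed ideal.axioms(1) maximalideal.axioms(1))

lemma (in domain) nonzero_pow: "x \<in> carrier R - {\<zero>} \<Longrightarrow> x [^] (n::nat) \<in> carrier R - {\<zero>}"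
  by (induction n) (auto simp: integral_iff)

text \<open>The elements \<open>c\<close> such that \<open>P\<close> holds uniformly on the basic open set \<open>D(c)\<close> form an ideal, so
  validity near every maximal ideal puts \<open>1\<close> into it.\<close>

lemma (in cring) locally_bounded_imp_bounded:
  fixes P :: "'a set \<Rightarrow> nat \<Rightarrow> bool"
  assumes mono: "\<And>M m n. m \<le> n \<Longrightarrow> P M m \<Longrightarrow> P M n"
    and local: "\<And>M. maximalideal M R \<Longrightarrow>
      \<exists>c\<in>carrier R - M. \<exists>B. \<forall>N. maximalideal N R \<longrightarrow> c \<notin> N \<longrightarrow> P N B"
  shows "\<exists>B. \<forall>N. maximalideal N R \<longrightarrow> P N B"
proof -
  define J where "J = {c \<in> carrier R. \<exists>B. \<forall>N. maximalideal N R \<longrightarrow> c \<notin> N \<longrightarrow> P N B}"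
  have "ideal J R"
  proof (rule idealI_closed)
    show "\<zero> \<in> J" by (auto simp: J_def zero_in_maximalideal)
    show "r \<otimes> x \<in> J" if "r \<in> carrier R" "x \<in> J" for r x
      using that maximalideal_mult_iff unfolding J_def by (auto; metis)
    fix x y assume "x \<in> J" "y \<in> J"
    then obtain B B' where B: "x \<in> carrier R" "y \<in> carrier R"
      "\<And>N. maximalideal N R \<Longrightarrow> x \<notin> N \<Longrightarrow> P N B" "\<And>N. maximalideal N R \<Longrightarrow> y \<notin> N \<Longrightarrow> P N B'"
      unfolding J_def by blast
    \<comment> \<open>The basic open set of \<open>x \<oplus> y\<close> is covered by those of
      \<open>x\<close> and \<open>y\<close>, and by monotonicity the larger bound serves on
      both.\<close>
    have "P N (max B B')" if N: "maximalideal N R" "x \<oplus> y \<notin> N" for N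
    proof (cases "x \<in> N")
      case True
      then have "y \<notin> N" using N maximalideal_add_cancel B by blast
      then show ?thesis using B(4)[OF N(1)] mono max.cobounded2 by blast
    next
      case False
      then show ?thesis using B(3)[OF N(1)] mono max.cobounded1 by blast
    qed
    then show "x \<oplus> y \<in> J" using B by (auto simp: J_def)
  qed (auto simp: J_def)
  have "\<one> \<in> J"
  proof (rule ccontr)
    assume "\<one> \<notin> J"
    then obtain M where M: "maximalideal M R" "J \<subseteq> M"
      using ideal_subset_maximalideal[OF \<open>ideal J R\<close>] by blast
    then show False using local[OF M(1)] unfolding J_def by blast
  qed
  then show ?thesis using one_notin_maximalideal unfolding J_def by blast
qed

section \<open>Domains with a valuation at each maximal ideal\<close>

text \<open>Values are natural numbers and every axiom speaks of nonzero elements, so the infinite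
  value at zero never has to be represented. \<open>v_le_imp_dvd\<close> expresses divisibility in
  the localization at \<open>M\<close> inside \<open>R\<close> itself, with \<open>c\<close> as the
  cleared denominator.\<close>

locale valued_domain = domain R for R :: "('a, 'm) ring_scheme" (structure) +
  fixes v :: "'a set \<Rightarrow> 'a \<Rightarrow> nat"
  assumes v_mult: "\<lbrakk>maximalideal M R; x \<in> carrier R - {\<zero>}; y \<in> carrier R - {\<zero>}\<rbrakk>
      \<Longrightarrow> v M (x \<otimes> y) = v M x + v M y"
    and v_pos_iff: "\<lbrakk>maximalideal M R; x \<in> carrier R - {\<zero>}\<rbrakk> \<Longrightarrow> 0 < v M x \<longleftrightarrow> x \<in> M"
    and v_le_imp_dvd: "\<lbrakk>maximalideal M R; x \<in> carrier R - {\<zero>}; y \<in> carrier R - {\<zero>}; v M x \<le> v M y\<rbrakk>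
      \<Longrightarrow> \<exists>c\<in>carrier R - M. \<exists>d\<in>carrier R. c \<otimes> y = x \<otimes> d"
    and uniformizer: "maximalideal M R \<Longrightarrow> \<exists>t\<in>carrier R - {\<zero>}. v M t = 1"
begin

lemma v_pow:
  assumes "maximalideal M R" "x \<in> carrier R - {\<zero>}"
  shows "v M (x [^] (n::nat)) = n * v M x"
proof (induction n)
  case 0
  have "v M \<one> = 0"
    using v_pos_iff[OF assms(1), of \<one>] one_notin_maximalideal[OF assms(1)] by auto
  then show ?case by simp
next
  case (Suc n)
  have "x [^] n \<in> carrier R - {\<zero>}" using assms(2) nonzero_pow by auto
  then show ?case using Suc v_mult[OF assms(1) _ assms(2)] by simp
qed

text \<open>Converse of \<open>v_le_imp_dvd\<close>: \<open>c\<close> has value zero at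
  \<open>M\<close>, so \<open>v M y = v M x + v M d\<close>. One equation serves at every maximal
  ideal omitting \<open>c\<close>, which spreads an inequality from a point to a
  neighbourhood.\<close>

lemma dvd_imp_v_le:
  assumes M: "maximalideal M R" and c: "c \<in> carrier R - M"
    and "x \<in> carrier R" "y \<in> carrier R - {\<zero>}" "d \<in> carrier R" "c \<otimes> y = x \<otimes> d"
  shows "x \<noteq> \<zero>" "v M x \<le> v M y"
proof -
  have c0: "c \<in> carrier R - {\<zero>}" using c zero_in_maximalideal[OF M] by auto
  then have "c \<otimes> y \<noteq> \<zero>" using assms(4) integral[of c y] by blast
  then have x: "x \<in> carrier R - {\<zero>}" "d \<in> carrier R - {\<zero>}"
    using assms by auto
  then show "x \<noteq> \<zero>" by simp
  have "v M y = v M (c \<otimes> y)"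
    using v_pos_iff[OF M c0] c v_mult[OF M c0 assms(4)] by auto
  also have "\<dots> = v M x + v M d"
    using v_mult[OF M x] assms(6) by simp
  finally show "v M x \<le> v M y" by simp
qed

text \<open>The element of smaller value divides the other one in the localization at
  \<open>M\<close>, hence also the sum.\<close>

lemma v_add_ge:
  assumes M: "maximalideal M R" and "x \<in> carrier R - {\<zero>}" "y \<in> carrier R - {\<zero>}" "x \<oplus> y \<noteq> \<zero>"
  shows "min (v M x) (v M y) \<le> v M (x \<oplus> y)"
proof -
  have *: "v M x \<le> v M (x \<oplus> y)"
    if xy: "x \<in> carrier R - {\<zero>}" "y \<in> carrier R - {\<zero>}" "x \<oplus> y \<noteq> \<zero>" and le: "v M x \<le> v M y" for x y
  proof -
    obtain c d where cd: "c \<in> carrier R - M" "d \<in> carrier R" "c \<otimes> y = x \<otimes> d"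
      using v_le_imp_dvd[OF M xy(1,2) le] by blast
    have "c \<otimes> (x \<oplus> y) = x \<otimes> (c \<oplus> d)"
      using cd xy by (simp add: r_distr m_comm)
    then show ?thesis
      using dvd_imp_v_le(2)[OF M cd(1), of x "x \<oplus> y" "c \<oplus> d"] xy cd by auto
  qed
  show ?thesis
  proof (cases "v M x \<le> v M y")
    case True
    then show ?thesis using * assms by simp
  next
    case False
    then show ?thesis using *[of y x] assms a_comm[of x y] by auto
  qed
qed

text \<open>Locally at \<open>M\<close> the ideal \<open>I\<close> is generated by an element
  \<open>x\<close> of least value. Finite generation lets a single denominator \<open>c\<close>
  witness this near \<open>M\<close>, so \<open>B\<close> bounds the value of \<open>x\<close>
  there. As \<open>x\<close> lies in \<open>M\<close>, a power of \<open>x\<close> is locally a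
  multiple of \<open>b\<close>, which bounds \<open>b\<close>.\<close>

lemma bounded_near_bounded_ideal:
  assumes M: "maximalideal M R" and b: "b \<in> carrier R - {\<zero>}"
    and S: "finite S" "S \<subseteq> carrier R" and I: "I = Idl S" "I \<noteq> {\<zero>}" "I \<subseteq> M"
    and B: "\<And>N. maximalideal N R \<Longrightarrow> \<exists>y\<in>I - {\<zero>}. v N y \<le> B"
  shows "\<exists>c\<in>carrier R - M. \<exists>B. \<forall>N. maximalideal N R \<longrightarrow> c \<notin> N \<longrightarrow> v N b \<le> B"
proof -
  interpret I: ideal I R unfolding I(1) by (rule genideal_ideal[OF S(2)])
  have "\<exists>x. x \<in> I - {\<zero>}" using I(2) I.zero_closed by blast
  then obtain x where x: "x \<in> I - {\<zero>}" and xmin: "\<And>y. y \<in> I - {\<zero>} \<Longrightarrow> v M x \<le> v M y"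
    using ex_has_least_nat[of "\<lambda>x. x \<in> I - {\<zero>}" _ "v M"] by blast
  have xR: "x \<in> carrier R - {\<zero>}" using x I.Icarr by auto
  have SI: "S \<subseteq> I" unfolding I(1) by (rule genideal_self[OF S(2)])
  have "\<exists>c\<in>carrier R - M. \<forall>s\<in>S. \<exists>d\<in>carrier R. c \<otimes> s = x \<otimes> d"
    using S(1) SI
  proof (induction S rule: finite_induct)
    case empty
    then show ?case using one_notin_maximalideal[OF M] by auto
  next
    case (insert s S)
    then obtain c where c: "c \<in> carrier R - M" "\<And>s. s \<in> S \<Longrightarrow> \<exists>d\<in>carrier R. c \<otimes> s = x \<otimes> d"
      by auto
    have sR: "s \<in> carrier R" using insert.prems I.Icarr by auto
    have "\<exists>c'\<in>carrier R - M. \<exists>d\<in>carrier R. c' \<otimes> s = x \<otimes> d"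
    proof (cases "s = \<zero>")
      case True
      then show ?thesis using one_notin_maximalideal[OF M] xR by (auto intro!: bexI[of _ \<one>] bexI[of _ \<zero>])
    next
      case False
      then show ?thesis
        using v_le_imp_dvd[OF M xR, of s] xmin[of s] insert.prems sR by auto
    qed
    then obtain c' d' where c': "c' \<in> carrier R - M" "d' \<in> carrier R" "c' \<otimes> s = x \<otimes> d'" by blast
    \<comment> \<open>The product of the denominators serves old and new generators alike, and it
      stays outside \<open>M\<close> because \<open>M\<close> is prime.\<close>
    have "\<exists>d\<in>carrier R. c \<otimes> c' \<otimes> r = x \<otimes> d" if r: "r \<in> insert s S" for r
    proof (cases "r = s")
      case True
      have "c \<otimes> c' \<otimes> r = c \<otimes> (c' \<otimes> s)" using c c' sR True by (simp add: m_assoc)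
      also have "\<dots> = x \<otimes> (c \<otimes> d')" using c c' xR by (simp add: m_lcomm)
      finally show ?thesis using c c' by blast
    next
      case False
      then obtain d where d: "d \<in> carrier R" "c \<otimes> r = x \<otimes> d" using c(2)[of r] r by blast
      have rR: "r \<in> carrier R" using r insert.prems I.Icarr by auto
      have "c \<otimes> c' \<otimes> r = c' \<otimes> (c \<otimes> r)" using c c' rR by (simp add: m_ac)
      also have "\<dots> = x \<otimes> (c' \<otimes> d)" using d c' xR by (simp add: m_lcomm)
      finally show ?thesis using d c' by blast
    qed
    then show ?case
      using c(1) c'(1) maximalideal_mult_iff[OF M] by (intro bexI[of _ "c \<otimes> c'"]) auto
  qed
  then obtain c where c: "c \<in> carrier R - M" "\<And>s. s \<in> S \<Longrightarrow> \<exists>d\<in>carrier R. c \<otimes> s = x \<otimes> d"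
    by blast
  \<comment> \<open>The elements that \<open>c\<close> multiplies into the multiples of
    \<open>x\<close> form an ideal, so checking the generators is enough.\<close>
  have "I \<subseteq> {y \<in> carrier R. \<exists>d\<in>carrier R. c \<otimes> y = x \<otimes> d}" (is "_ \<subseteq> ?J")
    unfolding I(1)
  proof (rule genideal_minimal)
    show "S \<subseteq> ?J" using c S by auto
    show "ideal ?J R"
    proof (rule idealI_closed)
      show "\<zero> \<in> ?J" using c xR by (auto intro!: bexI[of _ \<zero>])
      fix y z assume "y \<in> ?J" "z \<in> ?J"
      then obtain d d' where "y \<in> carrier R" "z \<in> carrier R" "d \<in> carrier R" "d' \<in> carrier R"
        "c \<otimes> y = x \<otimes> d" "c \<otimes> z = x \<otimes> d'" by blast
      then show "y \<oplus> z \<in> ?J" using c xR by (auto simp: r_distr intro!: bexI[of _ "d \<oplus> d'"])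
    next
      fix r y assume r: "r \<in> carrier R" and "y \<in> ?J"
      then obtain d where "y \<in> carrier R" "d \<in> carrier R" "c \<otimes> y = x \<otimes> d" by blast
      then show "r \<otimes> y \<in> ?J"
        using c xR r by (auto intro!: bexI[of _ "r \<otimes> d"]) (metis DiffD1 m_lcomm)
    qed auto
  qed
  then have Ic: "\<exists>d\<in>carrier R. c \<otimes> y = x \<otimes> d" if "y \<in> I" for y using that by blast
  \<comment> \<open>Since \<open>x\<close> has positive value at \<open>M\<close>, its power with
    exponent \<open>v M b\<close> is locally divisible by \<open>b\<close>.\<close>
  define m where "m = v M b"
  have xm: "x [^] m \<in> carrier R - {\<zero>}" using xR nonzero_pow by auto
  have "0 < v M x" using v_pos_iff[OF M xR] x I(3) by blast
  then have "v M b \<le> v M (x [^] m)" using v_pow[OF M xR, of m] by (simp add: m_def)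
  then obtain e f where e: "e \<in> carrier R - M" "f \<in> carrier R" "e \<otimes> x [^] m = b \<otimes> f"
    using v_le_imp_dvd[OF M b xm] by blast
  \<comment> \<open>Where \<open>c\<close> and \<open>e\<close> are both invertible,
    \<open>v N b \<le> m * v N x\<close> and \<open>v N x \<le> v N y \<le> B\<close>.\<close>
  have "v N b \<le> m * B" if N: "maximalideal N R" "c \<otimes> e \<notin> N" for N
  proof -
    have ce: "c \<in> carrier R - N" "e \<in> carrier R - N"
      using N c e maximalideal_mult_iff[OF N(1)] by auto
    obtain y where y: "y \<in> I - {\<zero>}" "v N y \<le> B" using B[OF N(1)] by blast
    obtain d where d: "d \<in> carrier R" "c \<otimes> y = x \<otimes> d" using Ic y by blast
    have "v N x \<le> v N y"
      using dvd_imp_v_le(2)[OF N(1) ce(1) _ _ d] xR y I.Icarr by auto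
    moreover have "v N b \<le> v N (x [^] m)"
      using dvd_imp_v_le(2)[OF N(1) ce(2) _ xm e(2,3)] b by auto
    ultimately show ?thesis
      using v_pow[OF N(1) xR, of m] y(2) by (metis le_trans mult_le_mono2)
  qed
  moreover have "c \<otimes> e \<in> carrier R - M"
    using c e maximalideal_mult_iff[OF M] by auto
  ultimately show ?thesis by blast
qed

section \<open>Zero sets when the Jacobson radical is nonzero\<close>

text \<open>At a maximal ideal containing \<open>x\<close>, a high power of \<open>x\<close> is
  locally divisible by \<open>a\<close>. Hence the \<open>c\<close> with some
  \<open>c \<otimes> x [^] m\<close> in the ideal of \<open>a\<close> generate, together with
  \<open>x\<close>, the unit ideal. If \<open>c\<close> and a multiple of \<open>x\<close> sum to
  \<open>\<one>\<close>, then \<open>c\<close> and \<open>x\<close> share no maximal ideal, while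
  \<open>c \<otimes> x [^] m\<close> lies in all of them with \<open>a\<close>.\<close>

lemma clopen_zero_set:
  assumes a: "a \<in> carrier R - {\<zero>}" "\<And>M. maximalideal M R \<Longrightarrow> a \<in> M" and x: "x \<in> carrier R"
  obtains x' where "x' \<in> carrier R" "\<And>M. maximalideal M R \<Longrightarrow> x' \<in> M \<longleftrightarrow> x \<notin> M"
proof (cases "x = \<zero>")
  case True
  then show thesis using that[of \<one>] one_notin_maximalideal zero_in_maximalideal by auto
next
  case False
  \<comment> \<open>\<open>J\<close> is the saturation of the principal ideal of \<open>a\<close>
    with respect to \<open>x\<close>.\<close>
  define J where "J = {c \<in> carrier R. \<exists>m::nat. \<exists>e\<in>carrier R. c \<otimes> x [^] m = a \<otimes> e}"
  have "ideal J R"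
  proof (rule idealI_closed)
    show "\<zero> \<in> J" using a x by (auto simp: J_def intro!: exI[of _ 0] bexI[of _ \<zero>])
    show "r \<otimes> c \<in> J" if rc: "r \<in> carrier R" "c \<in> J" for r c
    proof -
      obtain m :: nat and e where "c \<in> carrier R" "e \<in> carrier R" "c \<otimes> x [^] m = a \<otimes> e"
        using rc(2) unfolding J_def by blast
      moreover from this have "r \<otimes> c \<otimes> x [^] m = a \<otimes> (r \<otimes> e)"
        using rc(1) a x by (simp add: m_assoc m_lcomm)
      ultimately show ?thesis unfolding J_def using rc(1) m_closed by blast
    qed
    fix c c' assume "c \<in> J" "c' \<in> J"
    then obtain m m' :: nat and e e' where
      *: "c \<in> carrier R" "e \<in> carrier R" "c \<otimes> x [^] m = a \<otimes> e"
      "c' \<in> carrier R" "e' \<in> carrier R" "c' \<otimes> x [^] m' = a \<otimes> e'"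
      unfolding J_def by blast
    have "(c \<oplus> c') \<otimes> x [^] (m + m') = (c \<otimes> x [^] m) \<otimes> x [^] m' \<oplus> (c' \<otimes> x [^] m') \<otimes> x [^] m"
    proof -
      have "(c \<oplus> c') \<otimes> (p \<otimes> q) = c \<otimes> p \<otimes> q \<oplus> c' \<otimes> q \<otimes> p"
        if "p \<in> carrier R" "q \<in> carrier R" for p q
        using *(1,4) that by algebra
      then show ?thesis using x by (simp add: nat_pow_mult[symmetric])
    qed
    also have "\<dots> = a \<otimes> (e \<otimes> x [^] m' \<oplus> e' \<otimes> x [^] m)"
      using * x a by (simp add: r_distr m_ac)
    finally show "c \<oplus> c' \<in> J"
      unfolding J_def using * x by blast
  qed (auto simp: J_def)
  define I where "I = J <+>\<^bsub>R\<^esub> PIdl x"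
  have I: "ideal I R"
    unfolding I_def using add_ideals[OF \<open>ideal J R\<close> cgenideal_ideal[OF x]] .
  have JI: "c \<oplus> r \<otimes> x \<in> I" if "c \<in> J" "r \<in> carrier R" for c r
    using that by (auto simp: I_def set_add_def' cgenideal_def)
  have xI: "x \<in> I"
    using JI[of \<zero> \<one>] additive_subgroup.zero_closed[OF ideal.axioms(1)[OF \<open>ideal J R\<close>]] x by auto
  have "\<one> \<in> I"
  proof (rule ccontr)
    assume "\<one> \<notin> I"
    then obtain M where M: "maximalideal M R" "I \<subseteq> M"
      using ideal_subset_maximalideal[OF I] by blast
    have x0: "x \<in> carrier R - {\<zero>}" "0 < v M x" "x [^] n \<in> carrier R - {\<zero>}" for n :: nat
      using x False M xI v_pos_iff[OF M(1), of x] nonzero_pow by auto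
    \<comment> \<open>The exponent \<open>v M a\<close> suffices because \<open>x\<close> has value
      at least one at \<open>M\<close>; the resulting \<open>c\<close> lies in \<open>J\<close> but
      not in \<open>M\<close>.\<close>
    then have "v M a \<le> v M (x [^] v M a)" using v_pow[OF M(1)] by simp
    then obtain c where c: "c \<in> carrier R - M" "c \<in> J"
      using v_le_imp_dvd[OF M(1) a(1) x0(3)] unfolding J_def by blast
    have "c \<in> I" using JI[OF c(2) zero_closed] c x by auto
    then show False using c M by blast
  qed
  then obtain c r where cr: "c \<in> J" "r \<in> carrier R" "\<one> = c \<oplus> r \<otimes> x"
    by (auto simp: I_def set_add_def' cgenideal_def)
  then obtain m :: nat and e where e: "c \<in> carrier R" "e \<in> carrier R" "c \<otimes> x [^] m = a \<otimes> e"
    unfolding J_def by blast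
  show thesis
  proof (rule that[OF e(1)])
    fix M assume M: "maximalideal M R"
    have "a \<otimes> e \<in> M" using a(2)[OF M] maximalideal_mult_iff[OF M] a e by auto
    then have "c \<in> M \<or> x [^] m \<in> M"
      using maximalideal_mult_iff[OF M e(1), of "x [^] m"] e x by auto
    moreover have "x [^] k \<in> M \<Longrightarrow> x \<in> M" for k :: nat
      by (induction k) (use one_notin_maximalideal[OF M] maximalideal_mult_iff[OF M] x in auto)
    moreover have "\<not> (c \<in> M \<and> x \<in> M)"
      using maximalideal_add_cancel[OF M, of c "r \<otimes> x"] cr e x one_notin_maximalideal[OF M]
        maximalideal_mult_iff[OF M] by auto
    ultimately show "c \<in> M \<longleftrightarrow> x \<notin> M" by blast
  qed
qed

text \<open>A Baire category argument: otherwise nested nonempty clopen sets \<open>V(s\<^sub>n)\<close> with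
  \<open>v(a) \<ge> n\<close> on \<open>V(s\<^sub>n)\<close> would have a common point, where \<open>v(a)\<close> would be infinite.\<close>

lemma bounded_on_some_zero_set:
  assumes a: "a \<in> carrier R - {\<zero>}" "\<And>M. maximalideal M R \<Longrightarrow> a \<in> M"
  shows "\<exists>s\<in>carrier R. (\<exists>M. maximalideal M R \<and> s \<in> M) \<and>
    (\<exists>B. \<forall>M. maximalideal M R \<longrightarrow> s \<in> M \<longrightarrow> v M a \<le> B)"
proof (rule ccontr)
  assume unbounded: "\<not> ?thesis"
  have large: "\<exists>M. maximalideal M R \<and> s \<in> M \<and> B < v M a"
    if "s \<in> carrier R" "maximalideal M R" "s \<in> M" for s M B
    using unbounded that by (meson not_le)
  let ?P = "\<lambda>(n::nat) s. s \<in> carrier R \<and> (\<exists>M. maximalideal M R \<and> s \<in> M) \<and>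
    (\<forall>M. maximalideal M R \<longrightarrow> s \<in> M \<longrightarrow> n \<le> v M a)"
  have "\<exists>f. \<forall>n. ?P n (f n) \<and> (\<forall>M. maximalideal M R \<longrightarrow> f (Suc n) \<in> M \<longrightarrow> f n \<in> M)"
  proof (rule dependent_nat_choice)
    obtain M where "maximalideal M R"
      using ideal_subset_maximalideal[OF zeroideal] by auto
    \<comment> \<open>The sequence starts with \<open>\<zero>\<close>, whose zero set is the whole
      maximal spectrum.\<close>
    then show "\<exists>s. ?P 0 s" using zero_in_maximalideal by (intro exI[of _ \<zero>]) auto
  next
    fix s n assume s: "?P n s"
    then obtain M where M: "maximalideal M R" "s \<in> M" "n < v M a" using large by blast
    obtain t where t: "t \<in> carrier R - {\<zero>}" "v M t = 1" using uniformizer[OF M(1)] by blast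
    \<comment> \<open>At \<open>M\<close> the elements \<open>a\<close> and \<open>t [^] k\<close>
      have equal value; \<open>c\<close> and \<open>e\<close> will witness that they divide each
      other near \<open>M\<close>.\<close>
    define k where "k = v M a"
    have tk: "t [^] k \<in> carrier R - {\<zero>}" "v M (t [^] k) = k"
      using t nonzero_pow v_pow[OF M(1) t(1)] by auto
    obtain c d where c: "c \<in> carrier R - M" "d \<in> carrier R" "c \<otimes> a = t [^] k \<otimes> d"
      using v_le_imp_dvd[OF M(1) tk(1) a(1)] tk(2) k_def by auto
    obtain e f where e: "e \<in> carrier R - M" "f \<in> carrier R" "e \<otimes> t [^] k = a \<otimes> f"
      using v_le_imp_dvd[OF M(1) a(1) tk(1)] tk(2) k_def by auto
    \<comment> \<open>Complementing twice: \<open>r\<close> cuts out the part of the zero set of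
      \<open>s\<close> where \<open>c\<close> and \<open>e\<close> are both invertible.\<close>
    obtain s' where s': "s' \<in> carrier R" "\<And>N. maximalideal N R \<Longrightarrow> s' \<in> N \<longleftrightarrow> s \<notin> N"
      using clopen_zero_set[OF a, of s] s by blast
    obtain r where r: "r \<in> carrier R" "\<And>N. maximalideal N R \<Longrightarrow> r \<in> N \<longleftrightarrow> s' \<otimes> (c \<otimes> e) \<notin> N"
      using clopen_zero_set[OF a, of "s' \<otimes> (c \<otimes> e)"] s' c e by blast
    have r_iff: "r \<in> N \<longleftrightarrow> s \<in> N \<and> c \<notin> N \<and> e \<notin> N" if "maximalideal N R" for N
      using r(2)[OF that] s'(2)[OF that] maximalideal_mult_iff[OF that] s'(1) c(1) e(1) by auto
    have "Suc n \<le> v N a" if N: "maximalideal N R" "r \<in> N" for N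
    proof -
      have ce: "c \<in> carrier R - N" "e \<in> carrier R - N" using r_iff N c e by auto
      \<comment> \<open>On the new zero set \<open>v N a\<close> equals \<open>k * v N t\<close>. It
        is positive because \<open>a\<close> lies in every maximal ideal, so \<open>v N t\<close> is
        at least one and \<open>v N a\<close> at least \<open>k\<close>, which exceeds
        \<open>n\<close>.\<close>
      have "v N a \<le> v N (t [^] k)"
        using dvd_imp_v_le(2)[OF N(1) ce(2) _ tk(1) e(2,3)] a by auto
      moreover have "0 < v N a" using v_pos_iff[OF N(1) a(1)] a(2)[OF N(1)] by auto
      moreover have *: "v N (t [^] k) = k * v N t" using v_pow[OF N(1) t(1)] .
      ultimately have "0 < v N t" by (cases "v N t") auto
      then have "k \<le> v N (t [^] k)" using * by simp
      also have "\<dots> \<le> v N a"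
        using dvd_imp_v_le(2)[OF N(1) ce(1) _ a(1) c(2,3)] tk by auto
      finally show ?thesis using M(3) k_def by simp
    qed
    moreover have "r \<in> M" using r_iff[OF M(1)] M c e by auto
    ultimately show "\<exists>r. ?P (Suc n) r \<and> (\<forall>M. maximalideal M R \<longrightarrow> r \<in> M \<longrightarrow> s \<in> M)"
      using r(1) M(1) r_iff by (intro exI[of _ r]) blast
  qed
  then obtain f where f: "\<And>n. ?P n (f n)"
    and fSuc: "\<And>n M. maximalideal M R \<Longrightarrow> f (Suc n) \<in> M \<Longrightarrow> f n \<in> M" by blast
  have f_mono: "f n \<in> M" if M: "maximalideal M R" and "f m \<in> M" "n \<le> m" for n m M
    using that(3,2) by (induction rule: dec_induct) (use fSuc[OF M] in auto)
  \<comment> \<open>Compactness: these elements vanish on some zero set of the sequence. They form a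
    proper ideal as no such set is empty, and a maximal ideal above it is a common point.\<close>
  define J where "J = {x \<in> carrier R. \<exists>n. \<forall>M. maximalideal M R \<longrightarrow> f n \<in> M \<longrightarrow> x \<in> M}"
  have "ideal J R"
  proof (rule idealI_closed)
    show "\<zero> \<in> J" by (auto simp: J_def zero_in_maximalideal)
    show "r \<otimes> x \<in> J" if "r \<in> carrier R" "x \<in> J" for r x
      using that maximalideal_mult_iff unfolding J_def by (auto; metis)
    fix x y assume "x \<in> J" "y \<in> J"
    then obtain m n where mn: "x \<in> carrier R" "y \<in> carrier R"
      "\<And>M. maximalideal M R \<Longrightarrow> f m \<in> M \<Longrightarrow> x \<in> M"
      "\<And>M. maximalideal M R \<Longrightarrow> f n \<in> M \<Longrightarrow> y \<in> M" unfolding J_def by blast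
    have "x \<oplus> y \<in> M" if M: "maximalideal M R" "f (max m n) \<in> M" for M
      using mn(3,4)[OF M(1)] f_mono[OF M] maximalideal_add_cancel[OF M(1)] mn(2)
      by (metis max.cobounded1 max.cobounded2)
    then show "x \<oplus> y \<in> J" using mn(1,2) by (auto simp: J_def)
  qed (auto simp: J_def)
  moreover have "\<one> \<notin> J"
    using f one_notin_maximalideal unfolding J_def by blast
  ultimately obtain M where M: "maximalideal M R" "J \<subseteq> M"
    using ideal_subset_maximalideal by blast
  have "f n \<in> M" for n
    using f[of n] M(2) unfolding J_def by blast
  then have "n \<le> v M a" for n using f M(1) by blast
  then show False using not_less_eq_eq by blast
qed

text \<open>Adding \<open>a\<close>, which lies in every maximal ideal, does not change the zero set
  of \<open>q\<close>. On it \<open>q\<close> has value above \<open>B\<close> and \<open>a\<close>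
  at most \<open>B\<close>, so by the ultrametric inequality the sum cannot have value above
  \<open>B\<close>; elsewhere the sum has value zero.\<close>

lemma bounded_element_if_jacobson_nonzero:
  assumes a: "a \<in> carrier R - {\<zero>}" "\<And>M. maximalideal M R \<Longrightarrow> a \<in> M"
  shows "\<exists>b\<in>carrier R - {\<zero>}. (\<exists>M. maximalideal M R \<and> b \<in> M) \<and>
    (\<exists>B. \<forall>M. maximalideal M R \<longrightarrow> v M b \<le> B)"
proof -
  obtain s M B where s: "s \<in> carrier R" and M: "maximalideal M R" "s \<in> M"
    and B: "\<And>M. maximalideal M R \<Longrightarrow> s \<in> M \<Longrightarrow> v M a \<le> B"
    using bounded_on_some_zero_set[OF a] by blast
  \<comment> \<open>\<open>Suc B\<close> makes the value strictly larger than \<open>B\<close>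
    wherever \<open>s\<close> has positive value.\<close>
  define q where "q = s [^] Suc B"
  have q: "q \<in> carrier R" using s by (simp add: q_def)
  have q_iff: "q \<in> N \<longleftrightarrow> s \<in> N" if N: "maximalideal N R" for N
  proof -
    have "s [^] k \<in> N \<Longrightarrow> s \<in> N" for k :: nat
      by (induction k) (use one_notin_maximalideal[OF N] maximalideal_mult_iff[OF N] s in auto)
    then show ?thesis using maximalideal_mult_iff[OF N, of "s [^] B" s] s by (auto simp: q_def)
  qed
  define b where "b = a \<oplus> q"
  have bR: "b \<in> carrier R" using a q by (simp add: b_def)
  have b_iff: "b \<in> N \<longleftrightarrow> s \<in> N" if "maximalideal N R" for N
    using maximalideal_add_cancel[OF that a(2)[OF that] q] q_iff[OF that] by (simp add: b_def)
  have key: "b \<noteq> \<zero> \<and> v N b \<le> B" if N: "maximalideal N R" "s \<in> N" for N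
  proof (cases "q = \<zero>")
    \<comment> \<open>There is no information on the value of a zero \<open>q\<close>, but then
      \<open>b\<close> is \<open>a\<close> itself.\<close>
    case True
    then show ?thesis using a B[OF N] by (simp add: b_def)
  next
    case False
    then have q0: "q \<in> carrier R - {\<zero>}" "s \<in> carrier R - {\<zero>}"
      using q s by (auto simp: q_def)
    have "0 < v N s" using v_pos_iff[OF N(1) q0(2)] N by simp
    then have vq: "B < v N q" using v_pow[OF N(1) q0(2), of "Suc B"] unfolding q_def
      by (metis Suc_le_eq less_eq_Suc_le mult.commute mult_le_mono1 nat_mult_1 One_nat_def)
    \<comment> \<open>The sign is a factor whose value is a natural number, so it cannot lower the
      value of \<open>q\<close>.\<close>
    have mq: "\<ominus> q = \<ominus> \<one> \<otimes> q" using q by (simp add: l_minus)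
    have q': "\<ominus> q \<in> carrier R - {\<zero>}" using q0 by auto
    have m1: "\<ominus> \<one> \<in> carrier R - {\<zero>}" by auto
    have "v N (\<ominus> q) = v N (\<ominus> \<one>) + v N q" using v_mult[OF N(1) m1 q0(1)] mq by simp
    then have vq': "B < v N (\<ominus> q)" using vq by simp
    have ab: "a = b \<oplus> \<ominus> q" using a q unfolding b_def by (simp add: a_assoc r_neg)
    have "b \<noteq> \<zero>"
    proof
      assume "b = \<zero>"
      then have "a = \<ominus> q" using ab q by simp
      then show False using B[OF N] vq' by simp
    qed
    moreover have "\<not> B < v N b"
    proof
      assume "B < v N b"
      moreover have "min (v N b) (v N (\<ominus> q)) \<le> v N a"
        using v_add_ge[OF N(1) _ q', of b] bR \<open>b \<noteq> \<zero>\<close> a ab by auto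
      ultimately show False using vq' B[OF N] by simp
    qed
    ultimately show ?thesis by simp
  qed
  then have b0: "b \<in> carrier R - {\<zero>}" using M bR by auto
  have "v N b \<le> B" if N: "maximalideal N R" for N
    using key[OF N] v_pos_iff[OF N b0] b_iff[OF N] by (cases "s \<in> N") auto
  then show ?thesis using b0 M b_iff by blast
qed

end

section \<open>The valuation of a discrete valuation ring\<close>

locale dvr_in_field = field K for K :: "('a, 'm) ring_scheme" (structure) +
  fixes V :: "'a set"
  assumes V_sub: "V \<subseteq> carrier K" and dvr: "discrete_valuation_ring (subring_of K V)"
begin

sublocale V: principal_domain "subring_of K V"
  using dvr by (simp add: discrete_valuation_ring_def)

definition max_ideal :: "'a set"
  where "max_ideal = (THE M. maximalideal M (subring_of K V))"

lemma max_ideal: "maximalideal max_ideal (subring_of K V)"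
  and max_ideal_unique: "maximalideal M (subring_of K V) \<Longrightarrow> M = max_ideal"
proof -
  have ex1: "\<exists>!M. maximalideal M (subring_of K V)"
    using dvr by (simp add: discrete_valuation_ring_def)
  then show m: "maximalideal max_ideal (subring_of K V)"
    unfolding max_ideal_def by (rule theI')
  show "maximalideal M (subring_of K V) \<Longrightarrow> M = max_ideal"
    using ex1 m by blast
qed

sublocale max_ideal: maximalideal max_ideal "subring_of K V"
  by (rule max_ideal)

lemma one_notin_max_ideal: "\<one> \<notin> max_ideal"
  using V.one_notin_maximalideal[OF max_ideal] by simp

lemma V_closed [simp]: "x \<in> V \<Longrightarrow> y \<in> V \<Longrightarrow> x \<otimes> y \<in> V" "\<one> \<in> V"
  "x \<in> V \<Longrightarrow> x [^] (n::nat) \<in> V" "x \<in> V \<Longrightarrow> x \<in> carrier K"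
proof -
  have mult: "x \<otimes> y \<in> V" if "x \<in> V" "y \<in> V" for x y
    using V.m_closed that by simp
  then show "x \<in> V \<Longrightarrow> y \<in> V \<Longrightarrow> x \<otimes> y \<in> V" .
  show one: "\<one> \<in> V"
    using V.one_closed by simp
  show "x \<in> V \<Longrightarrow> x [^] (n::nat) \<in> V"
    by (induction n) (simp_all add: mult one)
  show "x \<in> V \<Longrightarrow> x \<in> carrier K"
    using V_sub by blast
qed

lemma PIdl_V: "PIdl\<^bsub>subring_of K V\<^esub> t = {r \<otimes> t | r. r \<in> V}"
  by (simp add: cgenideal_def)

lemma PIdl_zero: "PIdl\<^bsub>subring_of K V\<^esub> \<zero> = {\<zero>}"
  using V.cgenideal_eq_genideal[OF V.zero_closed] V.genideal_zero by simp

lemma max_ideal_mult: "x \<in> V \<Longrightarrow> y \<in> max_ideal \<Longrightarrow> x \<otimes> y \<in> max_ideal"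
  using max_ideal.I_l_closed by simp

lemma max_ideal_V: "x \<in> max_ideal \<Longrightarrow> x \<in> V"
  using max_ideal.Icarr by simp

text \<open>An element outside \<open>max_ideal\<close> generates an ideal contained in no maximal
  ideal, since \<open>max_ideal\<close> is the only one; this ideal therefore contains
  \<open>\<one>\<close>.\<close>

lemma unit_iff: "x \<in> Units (subring_of K V) \<longleftrightarrow> x \<in> V \<and> x \<notin> max_ideal"
proof
  assume x: "x \<in> Units (subring_of K V)"
  then obtain y where "x \<in> V" "y \<in> V" "y \<otimes> x = \<one>"
    by (auto simp: Units_def)
  then show "x \<in> V \<and> x \<notin> max_ideal"
    using max_ideal_mult one_notin_max_ideal by metis
next
  assume x: "x \<in> V \<and> x \<notin> max_ideal"
  have I: "ideal (PIdl\<^bsub>subring_of K V\<^esub> x) (subring_of K V)"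
    using V.cgenideal_ideal x by simp
  have xI: "x \<in> PIdl\<^bsub>subring_of K V\<^esub> x"
    using V.cgenideal_self x by simp
  have "\<one> \<in> PIdl\<^bsub>subring_of K V\<^esub> x"
  proof (rule ccontr)
    assume "\<one> \<notin> PIdl\<^bsub>subring_of K V\<^esub> x"
    then obtain M where "maximalideal M (subring_of K V)" "PIdl\<^bsub>subring_of K V\<^esub> x \<subseteq> M"
      using V.ideal_subset_maximalideal[OF I] by auto
    then show False using max_ideal_unique x xI by blast
  qed
  then obtain r where "r \<in> V" "\<one> = r \<otimes> x" by (auto simp: PIdl_V)
  moreover from this have "x \<otimes> r = \<one>" using x m_comm[of x r] by simp
  ultimately show "x \<in> Units (subring_of K V)"
    using x by (auto simp: Units_def)
qed

section \<open>Uniformizers and the value of a unit times a power\<close>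

lemma obtain_uniformizer:
  obtains t where "t \<in> V - {\<zero>}" "max_ideal = PIdl\<^bsub>subring_of K V\<^esub> t"
proof -
  obtain t where t: "t \<in> V" "max_ideal = PIdl\<^bsub>subring_of K V\<^esub> t"
    using V.exists_gen[OF max_ideal.is_ideal] by auto
  \<comment> \<open>Here it matters that a discrete valuation ring is not a field: a zero generator
    would make the zero ideal maximal.\<close>
  have "t \<noteq> \<zero>"
  proof
    assume "t = \<zero>"
    then have "max_ideal = {\<zero>}"
      using t PIdl_zero by simp
    then have "field (subring_of K V)"
      using V.zeromaximalideal_fieldI max_ideal by simp
    then show False using dvr by (simp add: discrete_valuation_ring_def)
  qed
  then show thesis using that t by blast
qed

text \<open>Since \<open>t'\<close> is a multiple of \<open>t\<close>, a larger \<open>n'\<close>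
  would leave, after cancelling \<open>t [^] n\<close>, a factor \<open>t'\<close> in the unit
  \<open>u\<close>. Two applications with exchanged roles show that the exponent does not depend on
  the uniformizer.\<close>

lemma power_decomposition_le:
  assumes t: "t \<in> V - {\<zero>}" "max_ideal = PIdl\<^bsub>subring_of K V\<^esub> t" and t': "t' \<in> max_ideal"
    and u: "u \<in> Units (subring_of K V)" "u' \<in> V" and eq: "u \<otimes> t [^] n = u' \<otimes> t' [^] (n'::nat)"
  shows "n' \<le> n"
proof (rule ccontr)
  assume less: "\<not> n' \<le> n"
  obtain w where w: "w \<in> V" "t' = w \<otimes> t" using t t' by (auto simp: PIdl_V)
  have tV: "t \<in> V" "t' \<in> V" "u \<in> V" using t t' u max_ideal_V unit_iff by auto
  \<comment> \<open>Of the \<open>n'\<close> factors \<open>t'\<close>, \<open>n\<close> are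
    rewritten through \<open>t\<close> and one is kept to witness membership in
    \<open>max_ideal\<close>.\<close>
  have "n' = Suc (n' - Suc n) + n" using less by simp
  then have "t' [^] n' = t' [^] (n' - Suc n) \<otimes> t' \<otimes> t' [^] n"
    using tV by (metis V_closed(4) nat_pow_Suc nat_pow_mult)
  also have "t' [^] n = w [^] n \<otimes> t [^] n"
    using w tV by (simp add: nat_pow_distrib)
  finally have "u \<otimes> t [^] n = (u' \<otimes> t' [^] (n' - Suc n) \<otimes> w [^] n \<otimes> t') \<otimes> t [^] n"
    using eq w tV u by (simp add: m_ac)
  moreover have "t [^] n \<noteq> \<zero>" for n :: nat
    by (induction n) (use t tV in \<open>auto simp: integral_iff\<close>)
  ultimately have "u = u' \<otimes> t' [^] (n' - Suc n) \<otimes> w [^] n \<otimes> t'"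
    using m_rcancel[of "t [^] n"] w tV u by simp
  then have "u \<in> max_ideal" using max_ideal_mult t' w tV u by simp
  then show False using u unit_iff by blast
qed

text \<open>The description behind \<open>dvr_valuation\<close> ranges over all generators of the
  maximal ideal and all integer exponents. Nonnegative exponents are compared by
  \<open>power_decomposition_le\<close>; a negative one would make a unit a multiple of
  \<open>t'\<close>.\<close>

lemma dvr_valuation_eqI:
  assumes t: "t \<in> V - {\<zero>}" "max_ideal = PIdl\<^bsub>subring_of K V\<^esub> t"
    and u: "u \<in> Units (subring_of K V)" and x: "x = u \<otimes> t [^] (n::nat)"
  shows "dvr_valuation K V x = int n"
  unfolding dvr_valuation_def
proof (rule the_equality)
  show "\<exists>t\<in>V. \<exists>u\<in>Units (subring_of K V).
       maximalideal (PIdl\<^bsub>subring_of K V\<^esub> t) (subring_of K V) \<and> x = u \<otimes> t [^] int n"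
    using t u x max_ideal by (auto simp: int_pow_int)
next
  fix k :: int
  assume "\<exists>t\<in>V. \<exists>u\<in>Units (subring_of K V).
       maximalideal (PIdl\<^bsub>subring_of K V\<^esub> t) (subring_of K V) \<and> x = u \<otimes> t [^] k"
  then obtain t' u' where t': "t' \<in> V" "maximalideal (PIdl\<^bsub>subring_of K V\<^esub> t') (subring_of K V)"
    and u': "u' \<in> Units (subring_of K V)" and x': "x = u' \<otimes> t' [^] k"
    by blast
  have mt': "max_ideal = PIdl\<^bsub>subring_of K V\<^esub> t'" using max_ideal_unique t' by auto
  have mem: "t \<in> max_ideal" "t' \<in> max_ideal"
    using t mt' t' V.cgenideal_self by auto
  have uV: "u \<in> V" "u' \<in> V" using u u' unit_iff by auto
  have t'0: "t' \<noteq> \<zero>"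
  proof
    assume "t' = \<zero>"
    then have "max_ideal = {\<zero>}" using mt' PIdl_zero by simp
    then show False using mem t by blast
  qed
  show "k = int n"
  proof (cases "k < 0")
    case False
    then obtain j where j: "k = int j" by (metis nonneg_int_cases not_less)
    then have eq: "u \<otimes> t [^] n = u' \<otimes> t' [^] j" using x x' by (simp add: int_pow_int)
    have "j \<le> n" using power_decomposition_le[OF t mem(2) u uV(2) eq] .
    moreover have "n \<le> j"
      using power_decomposition_le[OF _ mt' mem(1) u' uV(1) eq[symmetric]] t' t'0 by auto
    ultimately show ?thesis using j by simp
  next
    case True
    \<comment> \<open>With the power moved to the other side, the successor guarantees at least one
      factor \<open>t'\<close> beside \<open>x\<close>.\<close>
    then obtain j where j: "k = - int (Suc j)"
      by (metis int_cases not_less of_nat_0_le_iff)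
    then have "t' [^] k = inv (t' [^] Suc j)"
      by (simp del: of_nat_Suc nat_pow_Suc add: int_pow_def nat_pow_def)
    moreover have "t' [^] Suc j \<in> Units K"
      using t' t'0 field_Units Units_pow_closed by (metis Diff_iff V_closed(4) singletonD)
    ultimately have "x \<otimes> t' [^] Suc j = u'"
      using x' uV by (metis Units_closed Units_inv_closed Units_l_inv V_closed(4) m_assoc r_one)
    moreover have xV: "x \<in> V" using x uV t by simp
    ultimately have "u' = (x \<otimes> t' [^] j) \<otimes> t'" using t' by (simp add: m_assoc)
    then have "u' \<in> max_ideal" using max_ideal_mult[OF _ mem(2)] xV t' by simp
    then show ?thesis using u' unit_iff by blast
  qed
qed

text \<open>The intersection \<open>J\<close> of the ideals generated by powers of \<open>t\<close>
  is principal, generated by \<open>z\<close>. Dividing \<open>z\<close> by \<open>t\<close> stays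
  inside \<open>J\<close>, so a nonzero \<open>z\<close> would make \<open>t\<close> a unit; hence
  \<open>J\<close> is zero. So some power of \<open>t\<close> does not divide \<open>x\<close>, and
  the quotient by the last one that does is a unit.\<close>

lemma unit_power_decomposition:
  assumes t: "t \<in> V - {\<zero>}" "max_ideal = PIdl\<^bsub>subring_of K V\<^esub> t" and x: "x \<in> V - {\<zero>}"
  obtains u n where "u \<in> Units (subring_of K V)" "x = u \<otimes> t [^] (n::nat)"
proof -
  define J where "J = {y \<in> V. \<forall>n::nat. \<exists>r\<in>V. y = r \<otimes> t [^] n}"
  have V_zero: "\<zero> \<in> V" using V.zero_closed by simp
  have V_add: "y \<oplus> z \<in> V" if "y \<in> V" "z \<in> V" for y z using V.a_closed that by simp
  have "ideal J (subring_of K V)"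
  proof (rule V.idealI_closed)
    show "J \<subseteq> carrier (subring_of K V)" by (auto simp: J_def)
    show "\<zero>\<^bsub>subring_of K V\<^esub> \<in> J" using V_zero t by (auto simp: J_def intro!: bexI[of _ \<zero>])
    fix y z assume yz: "y \<in> J" "z \<in> J"
    have "\<exists>r\<in>V. y \<oplus> z = r \<otimes> t [^] n" for n :: nat
    proof -
      obtain r r' where r: "r \<in> V" "r' \<in> V" "y = r \<otimes> t [^] n" "z = r' \<otimes> t [^] n"
        using yz unfolding J_def by blast
      then have "y \<oplus> z = (r \<oplus> r') \<otimes> t [^] n" using t by (simp add: l_distr)
      then show ?thesis using r V_add by blast
    qed
    then show "y \<oplus>\<^bsub>subring_of K V\<^esub> z \<in> J" using yz V_add by (auto simp: J_def)
  next
    fix r y assume r: "r \<in> carrier (subring_of K V)" and y: "y \<in> J"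
    have "\<exists>s\<in>V. r \<otimes> y = s \<otimes> t [^] n" for n :: nat
    proof -
      obtain s where s: "s \<in> V" "y = s \<otimes> t [^] n" using y unfolding J_def by blast
      then have "r \<otimes> y = (r \<otimes> s) \<otimes> t [^] n" using t r by (simp add: m_assoc)
      then show ?thesis using s r by (intro bexI[of _ "r \<otimes> s"]) auto
    qed
    then show "r \<otimes>\<^bsub>subring_of K V\<^esub> y \<in> J" using r y by (auto simp: J_def)
  qed
  then obtain z where z: "z \<in> V" "J = PIdl\<^bsub>subring_of K V\<^esub> z"
    using V.exists_gen by auto
  have zJ: "z \<in> J" using V.cgenideal_self z by simp
  have "z = \<zero>"
  proof (rule ccontr)
    assume z0: "z \<noteq> \<zero>"
    obtain r where r: "r \<in> V" "z = r \<otimes> t"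
      using zJ t unfolding J_def by (auto dest!: spec[of _ 1])
    \<comment> \<open>Divisibility of \<open>z\<close> by the next higher power gives that of
      \<open>r\<close>, after cancelling one \<open>t\<close>.\<close>
    have "\<exists>s\<in>V. r = s \<otimes> t [^] n" for n :: nat
    proof -
      obtain s where s: "s \<in> V" "z = s \<otimes> t [^] Suc n"
        using zJ unfolding J_def by blast
      then have "r \<otimes> t = (s \<otimes> t [^] n) \<otimes> t" using r t by (simp add: m_assoc)
      then have "r = s \<otimes> t [^] n" using m_rcancel[of t r "s \<otimes> t [^] n"] r s t by simp
      then show ?thesis using s by blast
    qed
    then have "r \<in> J" using r by (auto simp: J_def)
    then obtain w where w: "w \<in> V" "r = w \<otimes> z" using z by (auto simp: PIdl_V)
    then have "\<one> \<otimes> z = (w \<otimes> t) \<otimes> z" using r z t by (simp add: m_ac)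
    then have "\<one> = w \<otimes> t" using m_rcancel[of z \<one> "w \<otimes> t"] z0 z w t by simp
    then have "\<one> \<in> max_ideal" using t w by (auto simp: PIdl_V)
    then show False using one_notin_max_ideal by simp
  qed
  then have "J \<subseteq> {\<zero>}" using z by (auto simp: PIdl_V)
  then have ex: "\<exists>n::nat. \<not> (\<exists>r\<in>V. x = r \<otimes> t [^] n)" using x by (auto simp: J_def)
  \<comment> \<open>\<open>n\<close> is the first exponent that fails; it is not zero, as
    \<open>t [^] 0\<close> is \<open>\<one>\<close>, so its predecessor is the exponent
    sought.\<close>
  define n where "n = (LEAST n::nat. \<not> (\<exists>r\<in>V. x = r \<otimes> t [^] n))"
  have n: "\<not> (\<exists>r\<in>V. x = r \<otimes> t [^] n)" unfolding n_def by (rule LeastI_ex[OF ex])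
  have "n \<noteq> 0" using n x by (intro notI) auto
  then obtain k where k: "n = Suc k" by (cases n) auto
  then obtain r where r: "r \<in> V" "x = r \<otimes> t [^] k"
    using not_less_Least[of k "\<lambda>n. \<not> (\<exists>r\<in>V. x = r \<otimes> t [^] n)"] n_def by auto
  have "r \<notin> max_ideal"
  proof
    assume "r \<in> max_ideal"
    then obtain s where s: "s \<in> V" "r = s \<otimes> t" using t by (auto simp: PIdl_V)
    then have "x = s \<otimes> t [^] n" using r k t by (simp add: m_ac)
    then show False using n s by blast
  qed
  then show thesis using that r unit_iff by blast
qed

section \<open>Rules for the normalized valuation\<close>

lemma V_integral: "x \<in> V - {\<zero>} \<Longrightarrow> y \<in> V - {\<zero>} \<Longrightarrow> x \<otimes> y \<in> V - {\<zero>}"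
  using integral_iff[of x y] by auto

lemma dvr_valuation_nonneg:
  assumes "x \<in> V - {\<zero>}" shows "0 \<le> dvr_valuation K V x"
proof -
  obtain t where t: "t \<in> V - {\<zero>}" "max_ideal = PIdl\<^bsub>subring_of K V\<^esub> t" by (rule obtain_uniformizer)
  obtain u n where "u \<in> Units (subring_of K V)" "x = u \<otimes> t [^] (n::nat)"
    using unit_power_decomposition[OF t assms] by blast
  then show ?thesis using dvr_valuation_eqI[OF t] by simp
qed

lemma dvr_valuation_mult:
  assumes "x \<in> V - {\<zero>}" "y \<in> V - {\<zero>}"
  shows "dvr_valuation K V (x \<otimes> y) = dvr_valuation K V x + dvr_valuation K V y"
proof -
  obtain t where t: "t \<in> V - {\<zero>}" "max_ideal = PIdl\<^bsub>subring_of K V\<^esub> t" by (rule obtain_uniformizer)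
  obtain u n where u: "u \<in> Units (subring_of K V)" "x = u \<otimes> t [^] (n::nat)"
    using unit_power_decomposition[OF t assms(1)] by blast
  obtain w m where w: "w \<in> Units (subring_of K V)" "y = w \<otimes> t [^] (m::nat)"
    using unit_power_decomposition[OF t assms(2)] by blast
  have uw: "u \<otimes> w \<in> Units (subring_of K V)"
    using V.Units_m_closed[OF u(1) w(1)] by simp
  have "u \<in> V" "w \<in> V" using u w unit_iff by auto
  then have "x \<otimes> y = (u \<otimes> w) \<otimes> t [^] (n + m)"
    using u(2) w(2) t(1) by (simp add: nat_pow_mult[symmetric] m_ac)
  then have "dvr_valuation K V (x \<otimes> y) = int (n + m)" using dvr_valuation_eqI[OF t uw] by blast
  then show ?thesis
    using dvr_valuation_eqI[OF t u] dvr_valuation_eqI[OF t w] by simp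
qed

lemma dvr_valuation_pos_iff:
  assumes x: "x \<in> V - {\<zero>}" shows "0 < dvr_valuation K V x \<longleftrightarrow> x \<in> max_ideal"
proof -
  obtain t where t: "t \<in> V - {\<zero>}" "max_ideal = PIdl\<^bsub>subring_of K V\<^esub> t" by (rule obtain_uniformizer)
  obtain u n where u: "u \<in> Units (subring_of K V)" "x = u \<otimes> t [^] (n::nat)"
    using unit_power_decomposition[OF t x] by blast
  have uV: "u \<in> V" "u \<notin> max_ideal" using u unit_iff by auto
  have tm: "t \<in> max_ideal" using t V.cgenideal_self by auto
  have "0 < n \<longleftrightarrow> x \<in> max_ideal"
  proof (cases n)
    case 0
    then show ?thesis using u uV by simp
  next
    case (Suc k)
    then have "x = (u \<otimes> t [^] k) \<otimes> t" using u uV t by (simp add: m_assoc)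
    then show ?thesis using max_ideal_mult[OF _ tm] uV t Suc by simp
  qed
  then show ?thesis using dvr_valuation_eqI[OF t u] by simp
qed

lemma dvr_valuation_le_imp_dvd:
  assumes "x \<in> V - {\<zero>}" "y \<in> V - {\<zero>}" "dvr_valuation K V x \<le> dvr_valuation K V y"
  shows "\<exists>w\<in>V. y = x \<otimes> w"
proof -
  obtain t where t: "t \<in> V - {\<zero>}" "max_ideal = PIdl\<^bsub>subring_of K V\<^esub> t" by (rule obtain_uniformizer)
  obtain u n where u: "u \<in> Units (subring_of K V)" "x = u \<otimes> t [^] (n::nat)"
    using unit_power_decomposition[OF t assms(1)] by blast
  obtain w m where w: "w \<in> Units (subring_of K V)" "y = w \<otimes> t [^] (m::nat)"
    using unit_power_decomposition[OF t assms(2)] by blast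
  have nm: "n \<le> m"
    using assms(3) dvr_valuation_eqI[OF t u] dvr_valuation_eqI[OF t w] by simp
  obtain u' where u': "u' \<in> V" "u \<otimes> u' = \<one>" using u(1) by (auto simp: Units_def)
  have uw: "u \<in> V" "w \<in> V" using u w unit_iff by auto
  have "x \<otimes> (u' \<otimes> w \<otimes> t [^] (m - n)) = (u \<otimes> u') \<otimes> w \<otimes> (t [^] n \<otimes> t [^] (m - n))"
    using u(2) u'(1) uw t(1) by (simp add: m_ac)
  also have "\<dots> = y" using nm w(2) u' uw t(1) by (simp add: nat_pow_mult)
  finally have "y = x \<otimes> (u' \<otimes> w \<otimes> t [^] (m - n))" by simp
  then show ?thesis using u' uw t(1) by (intro bexI[of _ "u' \<otimes> w \<otimes> t [^] (m - n)"]) auto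
qed

lemma dvr_valuation_uniformizer:
  obtains t where "t \<in> V - {\<zero>}" "dvr_valuation K V t = 1"
proof -
  obtain t where t: "t \<in> V - {\<zero>}" "max_ideal = PIdl\<^bsub>subring_of K V\<^esub> t" by (rule obtain_uniformizer)
  have "\<one> \<in> Units (subring_of K V)" using unit_iff one_notin_max_ideal by simp
  then have "dvr_valuation K V t = int 1"
    by (rule dvr_valuation_eqI[OF t]) (use t in simp)
  then show thesis using that t by simp
qed

end

section \<open>Localizations at maximal ideals\<close>

locale dvr_localization = field K for K :: "('a, 'm) ring_scheme" (structure) +
  fixes D P :: "'a set"
  assumes D: "subdomain D K" and P: "maximalideal P (subring_of K D)"
    and dvr_loc: "discrete_valuation_ring (subring_of K (localization K D P))"
begin

abbreviation "V \<equiv> localization K D P"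

sublocale D: domain "subring_of K D"
  by (rule subdomain_is_domain[OF D])

sublocale P: maximalideal P "subring_of K D"
  by (rule P)

lemma D_closed: "x \<in> D \<Longrightarrow> x \<in> carrier K" "\<one> \<in> D" "x \<in> D \<Longrightarrow> y \<in> D \<Longrightarrow> x \<otimes> y \<in> D"
  using subdomainE[OF D] by auto

lemma one_notin_P: "\<one> \<notin> P"
  using D.one_notin_maximalideal[OF P] by simp

lemma zero_P: "\<zero> \<in> P" and P_D: "x \<in> P \<Longrightarrow> x \<in> D"
  using P.zero_closed P.Icarr by auto

lemma D_Units: "s \<in> D - P \<Longrightarrow> s \<in> Units K"
  using field_Units D_closed(1) zero_P by auto

sublocale dvr_in_field K V
proof
  show "V \<subseteq> carrier K"
    using D_closed D_Units by (auto simp: localization_def)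
qed (rule dvr_loc)

lemma D_subset_V: "D \<subseteq> V"
proof
  fix x assume "x \<in> D"
  then have "x = x \<otimes> inv \<one>" "x \<in> D" "\<one> \<in> D - P" using D_closed one_notin_P by auto
  then show "x \<in> V" unfolding localization_def by blast
qed

lemma V_E:
  assumes "y \<in> V" obtains d s where "d \<in> D" "s \<in> D - P" "y \<otimes> s = d"
proof -
  obtain d s where ds: "d \<in> D" "s \<in> D - P" "y = d \<otimes> inv s"
    using assms unfolding localization_def by blast
  then have "y \<otimes> s = d"
    using D_Units D_closed(1) by (simp add: m_assoc)
  then show thesis using that ds by blast
qed

lemma inv_V: "s \<in> D - P \<Longrightarrow> inv s \<in> V"
  unfolding localization_def using D_closed D_Units
  by (intro CollectI exI[of _ \<one>] exI[of _ s]) auto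

text \<open>An element of \<open>D\<close> outside \<open>P\<close> is invertible in
  \<open>V\<close>. Conversely, clearing the denominator \<open>s\<close> of an inverse of an
  element of \<open>P\<close> would put \<open>s\<close> into \<open>P\<close>.\<close>

lemma max_ideal_iff: "x \<in> D \<Longrightarrow> x \<in> max_ideal \<longleftrightarrow> x \<in> P"
proof
  assume x: "x \<in> D" "x \<in> max_ideal"
  show "x \<in> P"
  proof (rule ccontr)
    assume "x \<notin> P"
    then have "inv x \<in> V" "x \<in> Units K" using inv_V D_Units x by auto
    then have "\<one> \<in> max_ideal" using max_ideal_mult[of "inv x" x] x by simp
    then show False using one_notin_max_ideal by simp
  qed
next
  assume x: "x \<in> D" "x \<in> P"
  show "x \<in> max_ideal"
  proof (rule ccontr)
    assume "x \<notin> max_ideal"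
    then have "x \<in> Units (subring_of K V)" using x D_subset_V unit_iff by blast
    then obtain y where y: "y \<in> V" "x \<otimes> y = \<one>" by (auto simp: Units_def)
    obtain d s where ds: "d \<in> D" "s \<in> D - P" "y \<otimes> s = d" using V_E[OF y(1)] .
    have "s = (x \<otimes> y) \<otimes> s" using y ds D_closed by simp
    also have "\<dots> = x \<otimes> d" using ds x y(1) D_closed(1) V_closed(4) m_assoc[of x y s] by auto
    finally have "s \<in> P" using P.I_r_closed[of x d] x ds by simp
    then show False using ds by blast
  qed
qed

lemma dvr_valuation_unit: "s \<in> D - P \<Longrightarrow> dvr_valuation K V s = 0"
  using dvr_valuation_pos_iff[of s] dvr_valuation_nonneg[of s] max_ideal_iff[of s] D_subset_V zero_P
  by fastforce

text \<open>The ring \<open>T/(T \<inter> max_ideal)\<close> lies between \<open>D/P\<close> and \<open>V/max_ideal\<close>, and these two fields coincide.\<close>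

lemma contraction_maximalideal:
  assumes T: "subring T K" and DT: "D \<subseteq> T" "T \<subseteq> V"
  shows "maximalideal (T \<inter> max_ideal) (subring_of K T)"
proof -
  interpret T: cring "subring_of K T"
    using subring_is_domain[OF T] by (simp add: domain_def)
  note T_closed = subringE[OF T]
  have ideal: "ideal (T \<inter> max_ideal) (subring_of K T)"
  proof (rule T.idealI_closed)
    show "\<zero>\<^bsub>subring_of K T\<^esub> \<in> T \<inter> max_ideal" using T_closed max_ideal.zero_closed by simp
    show "x \<oplus>\<^bsub>subring_of K T\<^esub> y \<in> T \<inter> max_ideal" if "x \<in> T \<inter> max_ideal" "y \<in> T \<inter> max_ideal" for x y
      using that T_closed max_ideal.a_closed[of x y] by simp
    show "r \<otimes>\<^bsub>subring_of K T\<^esub> x \<in> T \<inter> max_ideal" if "r \<in> carrier (subring_of K T)" "x \<in> T \<inter> max_ideal" for r x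
      using that T_closed DT max_ideal_mult[of r x] by auto
  qed auto
  show ?thesis
  proof (rule maximalidealI[OF ideal])
    show "carrier (subring_of K T) \<noteq> T \<inter> max_ideal"
      using T_closed one_notin_max_ideal by auto
    fix J assume J: "ideal J (subring_of K T)" "T \<inter> max_ideal \<subseteq> J" "J \<subseteq> carrier (subring_of K T)"
    interpret J: ideal J "subring_of K T" by fact
    show "J = T \<inter> max_ideal \<or> J = carrier (subring_of K T)"
    proof (cases "J \<subseteq> max_ideal")
      case True
      then show ?thesis using J by auto
    next
      case False
      then obtain y where y: "y \<in> J" "y \<notin> max_ideal" by blast
      then have yT: "y \<in> T" using J by auto
      then obtain d s where ds: "d \<in> D" "s \<in> D - P" "y \<otimes> s = d" using V_E DT by blast
      \<comment> \<open>Otherwise \<open>y\<close>, being \<open>d\<close> times the inverse of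
        \<open>s\<close>, would lie in \<open>max_ideal\<close>.\<close>
      have "d \<notin> P"
      proof
        assume "d \<in> P"
        then have "d \<in> max_ideal" using max_ideal_iff ds by blast
        moreover have "y = inv s \<otimes> d"
        proof -
          have yK: "y \<in> carrier K" using yT DT V_closed(4) by blast
          have s: "s \<in> Units K" "s \<in> carrier K" using D_Units[OF ds(2)] by auto
          have "inv s \<otimes> d = y \<otimes> (inv s \<otimes> s)"
            using m_lcomm[of "inv s" y s] s yK by (simp flip: ds(3))
          then show ?thesis using s yK by simp
        qed
        ultimately show False using y inv_V[OF ds(2)] max_ideal_mult by blast
      qed
      \<comment> \<open>\<open>e\<close> inverts \<open>d\<close> modulo \<open>P\<close>. So
        \<open>\<one>\<close> is the sum of \<open>p\<close>, in \<open>J\<close> as an element of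
        \<open>P\<close>, and \<open>d \<otimes> e\<close>, in \<open>J\<close> as a multiple of
        \<open>y\<close>.\<close>
      then obtain e where e: "e \<in> D" "\<one> \<ominus>\<^bsub>subring_of K D\<^esub> d \<otimes> e \<in> P"
        using D.maximalideal_notin_inverse[OF P, of d] ds by auto
      define p where "p = \<one> \<ominus>\<^bsub>subring_of K D\<^esub> d \<otimes> e"
      have pP: "p \<in> P" using e p_def by simp
      then have pJ: "p \<in> J" using P_D max_ideal_iff DT J by blast
      have "y \<otimes> (s \<otimes> e) \<in> J"
        using J.I_r_closed[OF y(1), of "s \<otimes> e"] D_closed(3)[of s e] ds(2) e(1) DT(1) by auto
      moreover have "y \<otimes> (s \<otimes> e) = d \<otimes> e"
        using ds e yT DT D_closed by (metis DiffD1 V_closed(4) m_assoc subsetD)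
      ultimately have "p \<oplus> d \<otimes> e \<in> J" using J.a_closed[OF pJ] by simp
      moreover have "p \<oplus> d \<otimes> e = \<one>"
      proof -
        have de: "d \<in> carrier (subring_of K D)" "e \<in> carrier (subring_of K D)" using ds e by auto
        have "(\<one>\<^bsub>subring_of K D\<^esub> \<ominus>\<^bsub>subring_of K D\<^esub> d \<otimes>\<^bsub>subring_of K D\<^esub> e)
            \<oplus>\<^bsub>subring_of K D\<^esub> d \<otimes>\<^bsub>subring_of K D\<^esub> e = \<one>\<^bsub>subring_of K D\<^esub>"
          using de by (simp only: D.minus_eq D.a_assoc D.l_neg D.m_closed D.one_closed D.a_inv_closed D.r_zero)
        then show ?thesis by (simp add: p_def)
      qed
      ultimately have "\<one>\<^bsub>subring_of K T\<^esub> \<in> J" by simp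
      then show ?thesis using J.one_imp_carrier by blast
    qed
  qed
qed

end

section \<open>Almost Dedekind domains\<close>

lemma almost_Dedekind_localization:
  assumes "almost_Dedekind K D" "maximalideal M (subring_of K D)"
  shows "dvr_localization K D M"
  using assms
  by (auto simp: almost_Dedekind_def is_quotient_field_def max_spec_def dvr_localization_def
      dvr_localization_axioms_def)

text \<open>For \<open>D\<close> almost Dedekind and \<open>M\<close> maximal, truncation loses
  nothing on nonzero elements of \<open>D\<close>: they lie in the localization and have nonnegative
  value.\<close>

abbreviation val_at :: "('a, 'm) ring_scheme \<Rightarrow> 'a set \<Rightarrow> 'a set \<Rightarrow> 'a \<Rightarrow> nat"
  where "val_at K D M x \<equiv> nat (dvr_valuation K (localization K D M) x)"

lemma almost_Dedekind_valued_domain: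
  assumes AD: "almost_Dedekind K D"
  shows "valued_domain (subring_of K D) (val_at K D)"
proof -
  have K: "field K" "subdomain D K" using AD by (auto simp: almost_Dedekind_def is_quotient_field_def)
  interpret K: field K by (rule K(1))
  interpret D: domain "subring_of K D" by (rule K.subdomain_is_domain[OF K(2)])
  show ?thesis
  proof
    fix M assume M: "maximalideal M (subring_of K D)"
    interpret L: dvr_localization K D M by (rule almost_Dedekind_localization[OF AD M])
    have DV: "x \<in> L.V - {\<zero>\<^bsub>K\<^esub>}" if "x \<in> carrier (subring_of K D) - {\<zero>\<^bsub>subring_of K D\<^esub>}" for x
      using that L.D_subset_V by auto
    show "\<exists>t\<in>carrier (subring_of K D) - {\<zero>\<^bsub>subring_of K D\<^esub>}. val_at K D M t = 1"
    proof -
      obtain t where t: "t \<in> L.V - {\<zero>\<^bsub>K\<^esub>}" "dvr_valuation K L.V t = 1"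
        by (rule L.dvr_valuation_uniformizer)
      \<comment> \<open>A uniformizer of the localization may be a proper fraction; its denominator
        \<open>s\<close> has value zero, so the numerator \<open>d\<close> is a uniformizer in
        \<open>D\<close>.\<close>
      obtain d s where ds: "d \<in> D" "s \<in> D - M" "t \<otimes>\<^bsub>K\<^esub> s = d" using L.V_E t by blast
      have sV: "s \<in> L.V - {\<zero>\<^bsub>K\<^esub>}" using ds L.D_subset_V L.zero_P by auto
      have "dvr_valuation K L.V d = 1"
        using L.dvr_valuation_mult[OF t(1) sV] L.dvr_valuation_unit[OF ds(2)] t(2) ds(3) by simp
      moreover have "d \<noteq> \<zero>\<^bsub>K\<^esub>" using L.V_integral[OF t(1) sV] ds(3) by auto
      ultimately show ?thesis using ds by (intro bexI[of _ d]) auto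
    qed
    fix x assume x: "x \<in> carrier (subring_of K D) - {\<zero>\<^bsub>subring_of K D\<^esub>}"
    show "0 < val_at K D M x \<longleftrightarrow> x \<in> M"
      using L.dvr_valuation_pos_iff[OF DV[OF x]] L.max_ideal_iff[of x] x by simp
    fix y assume y: "y \<in> carrier (subring_of K D) - {\<zero>\<^bsub>subring_of K D\<^esub>}"
    show "val_at K D M (x \<otimes>\<^bsub>subring_of K D\<^esub> y) = val_at K D M x + val_at K D M y"
      using L.dvr_valuation_mult[OF DV[OF x] DV[OF y]] L.dvr_valuation_nonneg DV x y
      by (simp add: nat_add_distrib)
    assume le: "val_at K D M x \<le> val_at K D M y"
    have "dvr_valuation K L.V x \<le> dvr_valuation K L.V y"
      using le L.dvr_valuation_nonneg[OF DV[OF x]] L.dvr_valuation_nonneg[OF DV[OF y]] by simp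
    then obtain w where w: "w \<in> L.V" "y = x \<otimes>\<^bsub>K\<^esub> w"
      using L.dvr_valuation_le_imp_dvd[OF DV[OF x] DV[OF y]] by blast
    \<comment> \<open>Clearing the denominator of the quotient \<open>w\<close> yields an equation
      inside \<open>D\<close>.\<close>
    obtain d s where ds: "d \<in> D" "s \<in> D - M" "w \<otimes>\<^bsub>K\<^esub> s = d" using L.V_E[OF w(1)] .
    have "s \<otimes>\<^bsub>K\<^esub> y = x \<otimes>\<^bsub>K\<^esub> d"
      using ds w x L.D_closed L.V_closed(4) by (auto simp: K.m_ac)
    then show "\<exists>c\<in>carrier (subring_of K D) - M. \<exists>d\<in>carrier (subring_of K D).
        c \<otimes>\<^bsub>subring_of K D\<^esub> y = x \<otimes>\<^bsub>subring_of K D\<^esub> d"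
      using ds by auto
  qed
qed

section \<open>From values of elements to boundedness of ideals\<close>

text \<open>Two crude bounds suffice: the infimum over the ideal of \<open>b\<close> is at most the
  value of \<open>b\<close>, and it is nonnegative because the ideal lies in each localization.
  Membership of \<open>b\<close> in \<open>M\<close> keeps the ideal proper.\<close>

lemma not_completely_unboundedI:
  assumes AD: "almost_Dedekind K D" and b: "b \<in> D - {\<zero>\<^bsub>K\<^esub>}"
    and M: "maximalideal M (subring_of K D)" "b \<in> M"
    and B: "\<And>N. maximalideal N (subring_of K D) \<Longrightarrow> val_at K D N b \<le> B"
  shows "\<not> completely_unbounded K D"
proof -
  interpret D: valued_domain "subring_of K D" "val_at K D"
    by (rule almost_Dedekind_valued_domain[OF AD])
  let ?I = "PIdl\<^bsub>subring_of K D\<^esub> b"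
  have I: "ideal ?I (subring_of K D)" "b \<in> ?I"
    using D.cgenideal_ideal D.cgenideal_self b by auto
  have "?I \<subseteq> M"
    using D.cgenideal_minimal[OF maximalideal.axioms(1)[OF M(1)] M(2)] .
  then have "?I \<noteq> D"
    using D.one_notin_maximalideal[OF M(1)] D.one_closed by auto
  moreover have "\<bar>ideal_nu K D ?I N\<bar> \<le> int B" if N: "N \<in> max_spec (subring_of K D)" for N
  proof -
    have N': "maximalideal N (subring_of K D)" using N by (simp add: max_spec_def)
    interpret L: dvr_localization K D N by (rule almost_Dedekind_localization[OF AD N'])
    have nonneg: "0 \<le> dvr_valuation K L.V x" if "x \<in> ?I - {\<zero>\<^bsub>K\<^esub>}" for x
      using that L.dvr_valuation_nonneg[of x] L.D_subset_V ideal.Icarr[OF I(1), of x] by auto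
    have "ideal_nu K D ?I N \<le> dvr_valuation K L.V b"
      unfolding ideal_nu_def
      by (rule cINF_lower) (use nonneg I b in \<open>auto intro!: bdd_belowI2[of _ 0]\<close>)
    moreover have "0 \<le> ideal_nu K D ?I N"
      unfolding ideal_nu_def
      by (rule cINF_greatest) (use nonneg I b in auto)
    ultimately show ?thesis using B[OF N'] by linarith
  qed
  ultimately have "bounded_ideal K D ?I"
    unfolding bounded_ideal_def using I b by auto
  moreover have "principalideal ?I (subring_of K D)"
    using D.cgenideal_is_principalideal b by simp
  ultimately show ?thesis unfolding completely_unbounded_def by blast
qed

text \<open>It is enough to find a bound near each \<open>M\<close>. If \<open>b\<close> is not in
  \<open>M\<close>, its value vanishes wherever \<open>b\<close> is invertible; otherwise
  \<open>M\<close> is not critical and \<open>bounded_near_bounded_ideal\<close> applies.\<close>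

lemma bounded_if_notin_omega_Crit:
  assumes AD: "almost_Dedekind K D" and b: "b \<in> D - {\<zero>\<^bsub>K\<^esub>}"
    and crit: "\<And>P. P \<in> omega_Crit K D \<Longrightarrow> b \<notin> P"
  shows "\<exists>B. \<forall>N. maximalideal N (subring_of K D) \<longrightarrow> val_at K D N b \<le> B"
proof -
  interpret D: valued_domain "subring_of K D" "val_at K D"
    by (rule almost_Dedekind_valued_domain[OF AD])
  have b': "b \<in> carrier (subring_of K D) - {\<zero>\<^bsub>subring_of K D\<^esub>}" using b by simp
  show ?thesis
  proof (rule D.locally_bounded_imp_bounded)
    fix M assume M: "maximalideal M (subring_of K D)"
    show "\<exists>c\<in>carrier (subring_of K D) - M. \<exists>B. \<forall>N. maximalideal N (subring_of K D) \<longrightarrow>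
        c \<notin> N \<longrightarrow> val_at K D N b \<le> B"
    proof (cases "b \<in> M")
      case False
      have "val_at K D N b \<le> 0" if "maximalideal N (subring_of K D)" "b \<notin> N" for N
        using D.v_pos_iff[OF that(1) b'] that(2) by simp
      then show ?thesis using False b' by blast
    next
      case True
      then have "M \<notin> omega_Crit K D" using crit by blast
      then obtain I where I: "bounded_ideal K D I"
        "finitely_generated_ideal I (subring_of K D)" "I \<subseteq> M"
        using M unfolding omega_Crit_def max_spec_def by blast
      then obtain S where S: "finite S" "S \<subseteq> carrier (subring_of K D)"
        "I = Idl\<^bsub>subring_of K D\<^esub> S" unfolding finitely_generated_ideal_def by blast
      obtain B where B: "\<And>N. N \<in> max_spec (subring_of K D) \<Longrightarrow> \<bar>ideal_nu K D I N\<bar> \<le> B"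
        using I(1) unfolding bounded_ideal_def by blast
      have Iid: "ideal I (subring_of K D)" "I \<noteq> {\<zero>\<^bsub>K\<^esub>}" using I(1) by (auto simp: bounded_ideal_def)
      then have ne: "I - {\<zero>\<^bsub>K\<^esub>} \<noteq> {}"
        using additive_subgroup.zero_closed[OF ideal.axioms(1)[OF Iid(1)]] by auto
      show ?thesis
      proof (rule D.bounded_near_bounded_ideal[OF M b' S(1,2,3) _ I(3)])
        show "I \<noteq> {\<zero>\<^bsub>subring_of K D\<^esub>}" using Iid by simp
        fix N assume N: "maximalideal N (subring_of K D)"
        show "\<exists>y\<in>I - {\<zero>\<^bsub>subring_of K D\<^esub>}. val_at K D N y \<le> nat B"
        proof (rule ccontr)
          assume "\<not> ?thesis"
          then have "\<not> dvr_valuation K (localization K D N) y \<le> B" if "y \<in> I - {\<zero>\<^bsub>K\<^esub>}" for y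
            using that nat_mono[of _ B] by auto
          \<comment> \<open>Values are integers, so exceeding \<open>B\<close> improves to
            \<open>B + 1\<close>, a bound that survives the infimum.\<close>
          then have "B + 1 \<le> dvr_valuation K (localization K D N) y" if "y \<in> I - {\<zero>\<^bsub>K\<^esub>}" for y
            using that by fastforce
          then have "B + 1 \<le> ideal_nu K D I N"
            unfolding ideal_nu_def by (intro cINF_greatest[OF ne]) auto
          then show False using B[of N] N by (simp add: max_spec_def)
        qed
      qed
    qed
  qed simp
qed

text \<open>The element \<open>a\<close> is the numerator of a nonzero \<open>x\<close> in the
  radical. For critical \<open>P\<close>, \<open>contraction_maximalideal\<close> puts
  \<open>x\<close> into the maximal ideal of the localization; its multiple \<open>a\<close> follows
  and contracts into \<open>P\<close>.\<close>

lemma jacobson_omega_T1_element: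
  assumes AD: "almost_Dedekind K D"
    and jac: "jacobson_radical (subring_of K (omega_T1 K D)) \<noteq> {\<zero>\<^bsub>K\<^esub>}"
  obtains a where "a \<in> D - {\<zero>\<^bsub>K\<^esub>}" "\<And>P. P \<in> omega_Crit K D \<Longrightarrow> a \<in> P"
proof -
  have K: "field K" "subdomain D K"
    and frac: "\<And>x. x \<in> carrier K \<Longrightarrow> \<exists>a\<in>D. \<exists>b\<in>D - {\<zero>\<^bsub>K\<^esub>}. x = a \<otimes>\<^bsub>K\<^esub> inv\<^bsub>K\<^esub> b"
    using AD by (auto simp: almost_Dedekind_def is_quotient_field_def)
  interpret K: field K by (rule K(1))
  let ?T = "omega_T1 K D"
  have crit_max: "maximalideal P (subring_of K D)" if "P \<in> omega_Crit K D" for P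
    using that by (simp add: omega_Crit_def max_spec_def)
  have loc: "dvr_localization K D P" if "P \<in> omega_Crit K D" for P
    using almost_Dedekind_localization[OF AD crit_max[OF that]] .
  have DT: "D \<subseteq> ?T"
    using dvr_localization.D_subset_V[OF loc] subdomainE(1)[OF K(2)] by (auto simp: omega_T1_def)
  have "subring (localization K D P) K" if P: "P \<in> omega_Crit K D" for P
  proof -
    interpret L: dvr_localization K D P by (rule loc[OF P])
    show ?thesis using K.ring_incl_imp_subring[OF L.V_sub] L.V.ring_axioms by blast
  qed
  \<comment> \<open>Including \<open>carrier K\<close> keeps the intersected family nonempty even
    without critical ideals.\<close>
  then have "subring (\<Inter>(insert (carrier K) (localization K D ` omega_Crit K D))) K"
    using K.carrier_is_subring by (intro K.subring_Inter) auto
  then have T: "subring ?T K" by (simp add: omega_T1_def)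
  interpret T: ring "subring_of K ?T" by (rule K.subring_is_ring[OF T])
  have "\<zero>\<^bsub>K\<^esub> \<in> jacobson_radical (subring_of K ?T)"
    using T.zero_closed additive_subgroup.zero_closed[OF ideal.axioms(1)[OF maximalideal.axioms(1)]]
    by (fastforce simp: jacobson_radical_def max_spec_def)
  then obtain x where x: "x \<in> jacobson_radical (subring_of K ?T)" "x \<noteq> \<zero>\<^bsub>K\<^esub>"
    using jac by blast
  then have xT: "x \<in> ?T" "x \<in> carrier K" by (auto simp: jacobson_radical_def omega_T1_def)
  then obtain a b where ab: "a \<in> D" "b \<in> D - {\<zero>\<^bsub>K\<^esub>}" "x = a \<otimes>\<^bsub>K\<^esub> inv\<^bsub>K\<^esub> b"
    using frac by blast
  have abK: "a \<in> carrier K" "b \<in> Units K"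
    using ab subdomainE(1)[OF K(2)] K.field_Units by auto
  then have a_eq: "a = b \<otimes>\<^bsub>K\<^esub> x"
    using ab(3) by (simp add: K.m_lcomm K.Units_closed)
  have "a \<noteq> \<zero>\<^bsub>K\<^esub>" using ab(3) abK x(2) by auto
  moreover have "a \<in> P" if P: "P \<in> omega_Crit K D" for P
  proof -
    interpret L: dvr_localization K D P by (rule loc[OF P])
    have "?T \<subseteq> L.V" using P by (auto simp: omega_T1_def)
    then have "maximalideal (?T \<inter> L.max_ideal) (subring_of K ?T)"
      using L.contraction_maximalideal[OF T DT] by blast
    then have "x \<in> L.max_ideal"
      using x(1) by (auto simp: jacobson_radical_def max_spec_def)
    then have "a \<in> L.max_ideal"
      using a_eq L.max_ideal_mult L.D_subset_V ab(2) by blast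
    then show ?thesis using L.max_ideal_iff ab(1) by blast
  qed
  ultimately show thesis using that ab(1) by blast
qed

theorem proposition4p7:
  fixes K :: "('a, 'm) ring_scheme" and D :: "'a set"
  assumes "almost_Dedekind K D"
    and "jacobson_radical (subring_of K (omega_T1 K D)) \<noteq> {\<zero>\<^bsub>K\<^esub>}"
  shows "\<not> completely_unbounded K D"
proof -
  interpret D: valued_domain "subring_of K D" "val_at K D"
    by (rule almost_Dedekind_valued_domain[OF assms(1)])
  have bounded: ?thesis
    if "b \<in> D - {\<zero>\<^bsub>K\<^esub>}" "maximalideal M (subring_of K D)" "b \<in> M"
      "\<And>P. P \<in> omega_Crit K D \<Longrightarrow> b \<notin> P" for b M
    using bounded_if_notin_omega_Crit[OF assms(1) that(1,4)]
      not_completely_unboundedI[OF assms(1) that(1,2,3)] by blast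
  show ?thesis
  proof (cases "omega_Crit K D = {}")
    case True
    obtain M where M: "maximalideal M (subring_of K D)"
      using D.ideal_subset_maximalideal[OF D.zeroideal] D.one_not_zero by auto
    \<comment> \<open>Without critical ideals every nonzero element is bounded, so any nonzero
      nonunit will do.\<close>
    obtain t where "t \<in> D - {\<zero>\<^bsub>K\<^esub>}" "val_at K D M t = 1"
      using D.uniformizer[OF M] by auto
    then show ?thesis using bounded[of t M] M True D.v_pos_iff[OF M, of t] by auto
  next
    case False
    obtain a where a: "a \<in> D - {\<zero>\<^bsub>K\<^esub>}" "\<And>P. P \<in> omega_Crit K D \<Longrightarrow> a \<in> P"
      using jacobson_omega_T1_element[OF assms] by blast
    have a': "a \<in> carrier (subring_of K D) - {\<zero>\<^bsub>subring_of K D\<^esub>}" using a by simp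
    show ?thesis
    proof (cases "\<forall>M. maximalideal M (subring_of K D) \<longrightarrow> a \<in> M")
      case True
      then obtain b M B where "b \<in> D - {\<zero>\<^bsub>K\<^esub>}" "maximalideal M (subring_of K D)" "b \<in> M"
        "\<And>M. maximalideal M (subring_of K D) \<Longrightarrow> val_at K D M b \<le> B"
        using D.bounded_element_if_jacobson_nonzero[OF a'] by auto
      then show ?thesis using not_completely_unboundedI[OF assms(1)] by blast
    next
      case not_all: False
      then obtain M where M: "maximalideal M (subring_of K D)" "a \<notin> M" by blast
      obtain y where y: "y \<in> carrier (subring_of K D)"
        "\<one>\<^bsub>subring_of K D\<^esub> \<ominus>\<^bsub>subring_of K D\<^esub> a \<otimes>\<^bsub>subring_of K D\<^esub> y \<in> M"
        using D.maximalideal_notin_inverse[OF M(1) _ M(2)] a' by blast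
      let ?b = "\<one>\<^bsub>subring_of K D\<^esub> \<ominus>\<^bsub>subring_of K D\<^esub> a \<otimes>\<^bsub>subring_of K D\<^esub> y"
      have bD: "?b \<in> carrier (subring_of K D)"
        using y a' D.minus_closed D.m_closed D.one_closed by blast
      \<comment> \<open>As \<open>a\<close> lies in \<open>P\<close>, \<open>?b\<close> is congruent
        to \<open>\<one>\<close> modulo \<open>P\<close>.\<close>
      have notin: "?b \<notin> P" if P: "P \<in> omega_Crit K D" for P
      proof
        assume bP: "?b \<in> P"
        have P': "maximalideal P (subring_of K D)" using P by (simp add: omega_Crit_def max_spec_def)
        have "a \<otimes>\<^bsub>subring_of K D\<^esub> y \<in> P"
          using D.maximalideal_mult_iff[OF P'] a' a(2)[OF P] y(1) by blast
        moreover have "?b \<oplus>\<^bsub>subring_of K D\<^esub> a \<otimes>\<^bsub>subring_of K D\<^esub> y = \<one>\<^bsub>subring_of K D\<^esub>"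
          using y(1) a' by (simp only: D.minus_eq D.a_assoc D.l_neg D.m_closed D.one_closed
              D.a_inv_closed D.r_zero Diff_iff)
        ultimately show False
          using D.maximalideal_add_cancel[OF P' bP, of "a \<otimes>\<^bsub>subring_of K D\<^esub> y"]
            D.one_notin_maximalideal[OF P'] D.m_closed[of a y] a' y(1) by auto
      qed
      \<comment> \<open>In this case a critical ideal exists; it contains zero but not
        \<open>?b\<close>.\<close>
      moreover have "?b \<noteq> \<zero>\<^bsub>K\<^esub>"
      proof
        assume "?b = \<zero>\<^bsub>K\<^esub>"
        moreover obtain P where P: "P \<in> omega_Crit K D" using False by blast
        moreover have "\<zero>\<^bsub>K\<^esub> \<in> P"
          using D.zero_in_maximalideal[of P] P by (simp add: omega_Crit_def max_spec_def)
        ultimately show False using notin by metis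
      qed
      ultimately show ?thesis using bounded[OF _ M(1) y(2)] bD by auto
    qed
  qed
qed

end
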